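(* Let $\Delta_n$ be a permissible uniform flag complex on the vertex set $V_n$. Let $\mathcal{M}$ be the family of faces of $\Delta_n$ that are matchings, i.e. $\mathcal{M}=\{\{(i_1,j_1),\dots,(i_k,j_k)\}\in\Delta_n : |\{i_1,j_1,\dots,i_k,j_k\}|=2k\}$. Identify each arrow $(i,j)$ with the vertex $e_j-e_i$ of the root polytope. Then $\Delta_n$ represents a triangulation of $\partial P_n$ if and only if $\mathcal{M}$ satisfies: (SA) for any two disjoint subsets $I,J\subset\{1,\dots,n+1\}$ with $|I|=|J|$ there is a unique $\sigma\in\mathcal{M}$ with $\sigma\subseteq I\times J$ and $|\sigma|=|I|$; (LA) whenever $I,J$ are disjoint subsets of $\{1,\dots,n+1\}$ and $\sigma$ is a nonempty matching in $\mathcal{M}$ with $\sigma\subseteq I\times J$, then for each $k\notin I\cup J$ there is an arrow $(i,j)\in\sigma$ with $(\sigma-\{(i,j)\})\cup\{(k,j)\}\in\mathcal{M}$, and also for each $k\notin I\cup J$ there is an arrow $(i,j)\in\sigma$ with $(\sigma-\{(i,j)\})\cup\{(i,k)\}\in\mathcal{M}$.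
   Context: Let $e_1,\dots,e_{n+1}$ be the standard basis of $\mathbb{R}^{n+1}$; the root polytope $P_n$ is the convex hull of the points $e_j-e_i$, $i\ne j$. An arrow is an ordered pair $(i,j)$, $i\ne j$ in $\{1,\dots,n+1\}$ (tail $i$, head $j$); $V_n$ is the set of arrows. A simplicial complex on $V_n$ represents a triangulation of $\partial P_n$ if, identifying arrows with vertices, the convex hulls of its faces form a triangulation of $\partial P_n$. A set of arrows is admissible if it is contained in $I\times J$ for disjoint $I,J$. A simplicial complex $\Delta_n$ on $V_n$ is permissible if: (i) every face is admissible; (ii) for every face the underlying undirected graph is a forest; (iii) for every three distinct $i,j,k$ the sets $\{(i,j),(i,k)\}$ and $\{(j,i),(k,i)\}$ are edges; for any two disjoint pairs $\{i_1,i_2\},\{j_1,j_2\}$ exactly one of $\{(i_1,j_1),(i_2,j_2)\}$, $\{(i_1,j_2),(i_2,j_1)\}$ is an edge; and the 2-skeleton of $\Delta_n$ is flag. A flag complex on $V_n$ is a uniform flag complex if whether a pair $\{(i_1,j_1),(i_2,j_2)\}$ is an edge depends only on the equalities and inequalities among $i_1,i_2,j_1,j_2$. *)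

theory Defs
  imports "HOL-Analysis.Analysis"
begin

type_synonym arrow = "nat \<times> nat"  (* (tail, head) *)

definition arrows :: "nat \<Rightarrow> arrow set" where
  "arrows n = {(i, j). i \<in> {1..n+1} \<and> j \<in> {1..n+1} \<and> i \<noteq> j}"

text \<open>
  Abstract simplicial complexes are families of faces, closed under subsets; the empty face always
  belongs to the complex. Having vertex set \<open>V\<close> includes that every element of \<open>V\<close> is a vertex.
  All vertex sets used here are finite.
\<close>

definition abstract_complex_on :: "'a set \<Rightarrow> 'a set set \<Rightarrow> bool" where
  "abstract_complex_on V \<Delta> \<longleftrightarrow>
     {} \<in> \<Delta> \<and> (\<forall>v\<in>V. {v} \<in> \<Delta>) \<and> (\<forall>\<sigma>\<in>\<Delta>. \<sigma> \<subseteq> V) \<and> (\<forall>\<sigma>\<in>\<Delta>. \<forall>\<tau>\<subseteq>\<sigma>. \<tau> \<in> \<Delta>)"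

definition flag_complex :: "'a set \<Rightarrow> 'a set set \<Rightarrow> bool" where
  "flag_complex V \<Delta> \<longleftrightarrow>
     (\<forall>\<sigma>\<subseteq>V. (\<forall>a\<in>\<sigma>. \<forall>b\<in>\<sigma>. a \<noteq> b \<longrightarrow> {a, b} \<in> \<Delta>) \<longrightarrow> \<sigma> \<in> \<Delta>)"

text \<open>
  ``The \<open>k\<close>-skeleton of \<open>\<Delta>\<close> is flag'' is a condition on faces of dimension at most \<open>k\<close> only.
  It does not say that the \<open>k\<close>-skeleton, taken as a complex of its own, is a flag complex: that
  would forbid \<open>\<Delta>\<close> to have any face of dimension greater than \<open>k\<close>.
\<close>

definition flag_skeleton :: "nat \<Rightarrow> 'a set \<Rightarrow> 'a set set \<Rightarrow> bool" where
  "flag_skeleton k V \<Delta> \<longleftrightarrow>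
     (\<forall>\<sigma>\<subseteq>V. card \<sigma> \<le> k + 1 \<longrightarrow>
        (\<forall>a\<in>\<sigma>. \<forall>b\<in>\<sigma>. a \<noteq> b \<longrightarrow> {a, b} \<in> \<Delta>) \<longrightarrow> \<sigma> \<in> \<Delta>)"

definition admissible :: "nat \<Rightarrow> arrow set \<Rightarrow> bool" where
  "admissible n \<sigma> \<longleftrightarrow>
     (\<exists>I J. I \<subseteq> {1..n+1} \<and> J \<subseteq> {1..n+1} \<and> I \<inter> J = {} \<and> \<sigma> \<subseteq> I \<times> J)"

definition underlying_edges :: "arrow set \<Rightarrow> nat set set" where
  "underlying_edges \<sigma> = (\<lambda>(i, j). {i, j}) ` \<sigma>"

text \<open>
  A simple undirected graph, given by its set of two-element edges, is a forest iff it has no cycle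
  \<open>v\<^sub>0, v\<^sub>1, \<dots>, v\<^sub>m\<^sub>-\<^sub>1, v\<^sub>0\<close> with \<open>m \<ge> 3\<close> distinct vertices.
\<close>

definition is_forest :: "'a set set \<Rightarrow> bool" where
  "is_forest E \<longleftrightarrow>
     \<not> (\<exists>vs. distinct vs \<and> length vs \<ge> 3 \<and>
           (\<forall>m<length vs. {vs ! m, vs ! ((m + 1) mod length vs)} \<in> E))"

definition permissible :: "nat \<Rightarrow> arrow set set \<Rightarrow> bool" where
  "permissible n \<Delta> \<longleftrightarrow>
     abstract_complex_on (arrows n) \<Delta> \<and>
     (\<forall>\<sigma>\<in>\<Delta>. admissible n \<sigma>) \<and>
     (\<forall>\<sigma>\<in>\<Delta>. is_forest (underlying_edges \<sigma>)) \<and>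
     (\<forall>i\<in>{1..n+1}. \<forall>j\<in>{1..n+1}. \<forall>k\<in>{1..n+1}. i \<noteq> j \<and> i \<noteq> k \<and> j \<noteq> k \<longrightarrow>
        {(i, j), (i, k)} \<in> \<Delta> \<and> {(j, i), (k, i)} \<in> \<Delta>) \<and>
     (\<forall>i1\<in>{1..n+1}. \<forall>i2\<in>{1..n+1}. \<forall>j1\<in>{1..n+1}. \<forall>j2\<in>{1..n+1}.
        i1 \<noteq> i2 \<and> j1 \<noteq> j2 \<and> {i1, i2} \<inter> {j1, j2} = {} \<longrightarrow>
        ({(i1, j1), (i2, j2)} \<in> \<Delta>) \<noteq> ({(i1, j2), (i2, j1)} \<in> \<Delta>)) \<and>
     flag_skeleton 2 (arrows n) \<Delta>"

definition same_relative_order :: "nat list \<Rightarrow> nat list \<Rightarrow> bool" where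
  "same_relative_order xs ys \<longleftrightarrow>
     length xs = length ys \<and>
     (\<forall>p<length xs. \<forall>q<length xs.
        (xs ! p = xs ! q \<longleftrightarrow> ys ! p = ys ! q) \<and> (xs ! p < xs ! q \<longleftrightarrow> ys ! p < ys ! q))"

definition uniform_flag_complex :: "nat \<Rightarrow> arrow set set \<Rightarrow> bool" where
  "uniform_flag_complex n \<Delta> \<longleftrightarrow>
     abstract_complex_on (arrows n) \<Delta> \<and> flag_complex (arrows n) \<Delta> \<and>
     (\<forall>i1 j1 i2 j2 i1' j1' i2' j2'.
        {(i1, j1), (i2, j2), (i1', j1'), (i2', j2')} \<subseteq> arrows n \<longrightarrow>
        same_relative_order [i1, j1, i2, j2] [i1', j1', i2', j2'] \<longrightarrow>
        ({(i1, j1), (i2, j2)} \<in> \<Delta> \<longleftrightarrow> {(i1', j1'), (i2', j2')} \<in> \<Delta>))"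

definition matching_faces :: "arrow set set \<Rightarrow> arrow set set" where
  "matching_faces \<Delta> = {\<sigma> \<in> \<Delta>. card (fst ` \<sigma> \<union> snd ` \<sigma>) = 2 * card \<sigma>}"

definition SA :: "nat \<Rightarrow> arrow set set \<Rightarrow> bool" where
  "SA n M \<longleftrightarrow>
     (\<forall>I J. I \<subseteq> {1..n+1} \<and> J \<subseteq> {1..n+1} \<and> I \<inter> J = {} \<and> card I = card J \<longrightarrow>
        (\<exists>!\<sigma>. \<sigma> \<in> M \<and> \<sigma> \<subseteq> I \<times> J \<and> card \<sigma> = card I))"

definition LA :: "nat \<Rightarrow> arrow set set \<Rightarrow> bool" where
  "LA n M \<longleftrightarrow>
     (\<forall>I J \<sigma>. I \<subseteq> {1..n+1} \<and> J \<subseteq> {1..n+1} \<and> I \<inter> J = {} \<and>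
        \<sigma> \<in> M \<and> \<sigma> \<noteq> {} \<and> \<sigma> \<subseteq> I \<times> J \<longrightarrow>
        (\<forall>k \<in> {1..n+1} - (I \<union> J). \<exists>(i, j) \<in> \<sigma>. (\<sigma> - {(i, j)}) \<union> {(k, j)} \<in> M) \<and>
        (\<forall>k \<in> {1..n+1} - (I \<union> J). \<exists>(i, j) \<in> \<sigma>. (\<sigma> - {(i, j)}) \<union> {(i, k)} \<in> M))"

text \<open>
  In the geometric part, \<open>e 1, \<dots>, e (n+1)\<close> is the standard basis of the ambient space.
\<close>

definition arrow_vertex :: "(nat \<Rightarrow> 'v::euclidean_space) \<Rightarrow> arrow \<Rightarrow> 'v" where
  "arrow_vertex e = (\<lambda>(i, j). e j - e i)"

definition root_polytope :: "nat \<Rightarrow> (nat \<Rightarrow> 'v::euclidean_space) \<Rightarrow> 'v set" where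
  "root_polytope n e = convex hull (arrow_vertex e ` arrows n)"

text \<open>
  The root polytope has codimension 1 in the ambient space, so its boundary is the relative
  frontier. The first conjunct says that the hull of a face \<open>\<sigma>\<close> is a simplex whose vertices are
  exactly the points of \<open>\<sigma>\<close>. The empty face contributes the empty simplex.
\<close>

definition represents_triangulation ::
    "nat \<Rightarrow> (nat \<Rightarrow> 'v::euclidean_space) \<Rightarrow> arrow set set \<Rightarrow> bool" where
  "represents_triangulation n e \<Delta> \<longleftrightarrow>
     (\<forall>\<sigma>\<in>\<Delta>. \<not> affine_dependent (arrow_vertex e ` \<sigma>)) \<and>
     triangulation ((\<lambda>\<sigma>. convex hull (arrow_vertex e ` \<sigma>)) ` \<Delta>) \<and>
     (\<Union>\<sigma>\<in>\<Delta>. convex hull (arrow_vertex e ` \<sigma>)) = rel_frontier (root_polytope n e)"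

end

theory Submission
  imports Defs
begin

text \<open>
  Whenever every point of the boundary is, in exactly one way, a positive combination of the arrows of
  a face, the faces triangulate the boundary. Uniqueness is \<open>SA\<close>: two representations of a point
  differ by a circulation, and following it with alternating signs produces two matchings of the
  same sets. For existence, \<open>LA\<close> lets one attach a new vertex to any face as a leaf; attaching all
  heads of one face and all tails of another and comparing the two results by \<open>SA\<close> shows that any
  two vertex-disjoint parts of a face can be joined by an arrow in either direction. Hence walls
  inside the cone over a facet can be crossed, and a generic segment starting in the cone of
  a spanning tree never leaves the union of the cones.

  Conversely, the matchings in \<open>SA\<close> are the carriers of barycentres, and \<open>LA\<close> is seen by looking at
  the carriers of points close to a barycentre.
\<close>

text \<open>\<open>SA\<close> and \<open>LA\<close> speak of matchings, whereas circulations,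
  attachments and joins involve arbitrary faces. The bridge is always to choose successors and pass
  to a minimal invariant set, where the choice is a permutation and the chosen arrows form a
  matching. In a face no vertex is both tail and head, so nothing cancels: the signs of the
  coordinates of a point give the tails and heads of every representation, and \<open>l1\<close> is
  twice the total weight. The boundary is therefore the level \<open>l1 = 2\<close> in
  \<open>H\<close>, and it suffices that the cones fill \<open>H\<close>. Each cell of constant
  signs is treated by itself. Inside a cell, a segment can be continued through a face whose span
  has codimension at most one, because one joining arrow then supplies the missing direction.
  Avoiding smaller faces is what genericity is for. It cannot be asked at the starting point, which
  lies in all excluded subspaces; there, uniqueness identifies the carrier with the whole tree.
  Points that are not generic follow because the union of the cones is closed.\<close>

section \<open>Finite self-maps\<close>

text \<open>A smallest nonempty invariant subset works: its image is invariant too, hence not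
  smaller.\<close>

lemma finite_self_map_core:
  assumes "finite A" "A \<noteq> {}" "f ` A \<subseteq> A"
  obtains B where "B \<subseteq> A" "B \<noteq> {}" "f ` B = B" "inj_on f B"
proof -
  define Q where "Q B \<longleftrightarrow> B \<subseteq> A \<and> B \<noteq> {} \<and> f ` B \<subseteq> B" for B
  have "Q A" using assms by (simp add: Q_def)
  then obtain B where B: "Q B" and min: "\<And>C. Q C \<Longrightarrow> card B \<le> card C"
    using ex_has_least_nat[of Q A card] by blast
  have fin: "finite B" using B assms(1) finite_subset by (auto simp: Q_def)
  have "Q (f ` B)" using B by (auto simp: Q_def)
  then have "card B \<le> card (f ` B)" by (rule min)
  then have "f ` B = B" using B fin by (metis Q_def card_seteq)
  then show ?thesis using that B fin by (metis Q_def eq_card_imp_inj_on)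
qed

text \<open>In a smallest nonempty set in which every element has a successor, the image under any
  choice of successors is again such a set, so every choice is a permutation. Given a second
  successor of \<open>a\<close>, redirecting \<open>a\<close> alone would destroy injectivity. The
  full equivalence supplies the unrelated pairs on which \<open>attach_head\<close> relies.\<close>

lemma serial_relation_core:
  assumes "finite A" "A \<noteq> {}" and serial: "\<And>a. a \<in> A \<Longrightarrow> \<exists>b\<in>A. R a b"
  obtains B f where "B \<subseteq> A" "B \<noteq> {}" "bij_betw f B B"
    "\<And>a b. a \<in> B \<Longrightarrow> b \<in> B \<Longrightarrow> R a b \<longleftrightarrow> b = f a"
proof -
  define Q where "Q B \<longleftrightarrow> B \<subseteq> A \<and> B \<noteq> {} \<and> (\<forall>a\<in>B. \<exists>b\<in>B. R a b)" for B
  have "Q A" using assms by (simp add: Q_def)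
  then obtain B where B: "Q B" and min: "\<And>C. Q C \<Longrightarrow> card B \<le> card C"
    using ex_has_least_nat[of Q A card] by blast
  have fin: "finite B" using B assms(1) finite_subset by (auto simp: Q_def)
  have bij: "bij_betw g B B" if g: "\<And>a. a \<in> B \<Longrightarrow> g a \<in> B \<and> R a (g a)" for g
  proof -
    have sub: "g ` B \<subseteq> B" using g by blast
    have "Q (g ` B)" using B g sub unfolding Q_def by blast
    then have "card B \<le> card (g ` B)" by (rule min)
    then show ?thesis using fin sub
      by (metis bij_betw_def card_seteq eq_card_imp_inj_on)
  qed
  obtain f where f: "\<And>a. a \<in> B \<Longrightarrow> f a \<in> B \<and> R a (f a)"
    using B unfolding Q_def by metis
  have "R a b \<longleftrightarrow> b = f a" if ab: "a \<in> B" "b \<in> B" for a b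
  proof
    assume R: "R a b"
    show "b = f a"
    proof (rule ccontr)
      assume ne: "b \<noteq> f a"
      obtain c where c: "c \<in> B" "f c = b"
        using bij[OF f] ab(2) by (metis bij_betw_iff_bijections)
      have "bij_betw (f(a := b)) B B"
        by (rule bij) (use f R ab in auto)
      then have "inj_on (f(a := b)) B" by (rule bij_betw_imp_inj_on)
      then show False using c ne ab(1) by (auto simp: inj_on_def split: if_splits)
    qed
  qed (use f ab in auto)
  then show ?thesis using that[of B f] B bij[OF f] unfolding Q_def by blast
qed

section \<open>Combinatorics of the support and linkage axioms\<close>

lemma arrows_iff: "(i, j) \<in> arrows n \<longleftrightarrow> i \<in> {1..n+1} \<and> j \<in> {1..n+1} \<and> i \<noteq> j"
  by (simp add: arrows_def)

lemma finite_arrows: "finite (arrows n)"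
proof (rule finite_subset)
  show "arrows n \<subseteq> {1..n+1} \<times> {1..n+1}" by (auto simp: arrows_def)
qed simp

lemma swap_image_mem_iff:
  fixes \<sigma> :: "('a \<times> 'a) set"
  shows "\<sigma> \<in> (`) prod.swap ` \<Delta> \<longleftrightarrow> prod.swap ` \<sigma> \<in> \<Delta>"
proof
  assume "prod.swap ` \<sigma> \<in> \<Delta>"
  then have "prod.swap ` prod.swap ` \<sigma> \<in> (`) prod.swap ` \<Delta>" by blast
  then show "\<sigma> \<in> (`) prod.swap ` \<Delta>" by (simp add: image_image)
qed (auto simp: image_image)

text \<open>In \<open>exchange\<close>, disjointness of the two pairs is encoded by asking that all
  four combinations be arrows. In \<open>same_tail\<close> and \<open>same_head\<close> the two
  arrows may coincide.\<close>

locale arrow_complex =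
  fixes n :: nat and \<Delta> :: "arrow set set"
  assumes complex: "abstract_complex_on (arrows n) \<Delta>"
    and adm: "\<sigma> \<in> \<Delta> \<Longrightarrow> admissible n \<sigma>"
    and same_tail: "\<lbrakk>(i, j) \<in> arrows n; (i, k) \<in> arrows n\<rbrakk> \<Longrightarrow> {(i, j), (i, k)} \<in> \<Delta>"
    and same_head: "\<lbrakk>(j, i) \<in> arrows n; (k, i) \<in> arrows n\<rbrakk> \<Longrightarrow> {(j, i), (k, i)} \<in> \<Delta>"
    and exchange: "\<lbrakk>(i1, j1) \<in> arrows n; (i2, j2) \<in> arrows n; (i1, j2) \<in> arrows n;
        (i2, j1) \<in> arrows n; i1 \<noteq> i2; j1 \<noteq> j2\<rbrakk> \<Longrightarrow>
        ({(i1, j1), (i2, j2)} \<in> \<Delta>) \<noteq> ({(i1, j2), (i2, j1)} \<in> \<Delta>)"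
    and flag: "flag_complex (arrows n) \<Delta>"
begin

lemma empty_face: "{} \<in> \<Delta>"
  and face_arrows: "\<sigma> \<in> \<Delta> \<Longrightarrow> \<sigma> \<subseteq> arrows n"
  and subface: "\<sigma> \<in> \<Delta> \<Longrightarrow> \<tau> \<subseteq> \<sigma> \<Longrightarrow> \<tau> \<in> \<Delta>"
  and vertex_face: "a \<in> arrows n \<Longrightarrow> {a} \<in> \<Delta>"
  using complex unfolding abstract_complex_on_def by blast+

lemma finite_face: "\<sigma> \<in> \<Delta> \<Longrightarrow> finite \<sigma>"
  using face_arrows finite_arrows finite_subset by blast

lemma finite_complex: "finite \<Delta>"
  by (rule finite_subset[of _ "Pow (arrows n)"]) (use face_arrows finite_arrows in auto)

lemma pair_face: "\<sigma> \<in> \<Delta> \<Longrightarrow> a \<in> \<sigma> \<Longrightarrow> b \<in> \<sigma> \<Longrightarrow> {a, b} \<in> \<Delta>"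
  by (rule subface) auto

lemma face_if_pairs:
  "\<sigma> \<subseteq> arrows n \<Longrightarrow> (\<And>a b. a \<in> \<sigma> \<Longrightarrow> b \<in> \<sigma> \<Longrightarrow> a \<noteq> b \<Longrightarrow> {a, b} \<in> \<Delta>) \<Longrightarrow> \<sigma> \<in> \<Delta>"
  using flag unfolding flag_complex_def by simp

lemma insert_face:
  assumes "\<sigma> \<in> \<Delta>" "a \<in> arrows n" "\<And>b. b \<in> \<sigma> \<Longrightarrow> {a, b} \<in> \<Delta>"
  shows "insert a \<sigma> \<in> \<Delta>"
proof (rule face_if_pairs)
  show "insert a \<sigma> \<subseteq> arrows n" using assms face_arrows by blast
  fix b c assume "b \<in> insert a \<sigma>" "c \<in> insert a \<sigma>" "b \<noteq> c"
  then consider "b = a" "c \<in> \<sigma>" | "c = a" "b \<in> \<sigma>" | "b \<in> \<sigma>" "c \<in> \<sigma>" by blast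
  then show "{b, c} \<in> \<Delta>"
  proof cases
    case 2
    then show ?thesis using assms(3)[of b] by (simp add: insert_commute)
  qed (use assms(3) pair_face[OF assms(1)] in simp_all)
qed

lemma tails_heads_disjoint: "\<sigma> \<in> \<Delta> \<Longrightarrow> fst ` \<sigma> \<inter> snd ` \<sigma> = {}"
proof -
  assume "\<sigma> \<in> \<Delta>"
  from adm[OF this] obtain I J where "I \<inter> J = {}" "\<sigma> \<subseteq> I \<times> J"
    unfolding admissible_def by blast
  moreover have "fst ` \<sigma> \<subseteq> I" "snd ` \<sigma> \<subseteq> J" using \<open>\<sigma> \<subseteq> I \<times> J\<close> by auto
  ultimately show ?thesis by blast
qed

lemma face_vertices: "\<sigma> \<in> \<Delta> \<Longrightarrow> fst ` \<sigma> \<union> snd ` \<sigma> \<subseteq> {1..n+1}"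
proof -
  assume "\<sigma> \<in> \<Delta>"
  from face_arrows[OF this] show ?thesis by (auto simp: arrows_def)
qed

text \<open>Tails and heads of a face are disjoint by admissibility, so the vertex count splits into
  two counts, each at most \<open>card \<sigma>\<close>.\<close>

lemma matching_faces_iff:
  "\<sigma> \<in> matching_faces \<Delta> \<longleftrightarrow> \<sigma> \<in> \<Delta> \<and> inj_on fst \<sigma> \<and> inj_on snd \<sigma>"
proof (cases "\<sigma> \<in> \<Delta>")
  case True
  note fin = finite_face[OF True]
  have un: "card (fst ` \<sigma> \<union> snd ` \<sigma>) = card (fst ` \<sigma>) + card (snd ` \<sigma>)"
    using fin tails_heads_disjoint[OF True] by (intro card_Un_disjoint) auto
  have le: "card (fst ` \<sigma>) \<le> card \<sigma>" "card (snd ` \<sigma>) \<le> card \<sigma>"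
    using fin card_image_le by blast+
  have "card (fst ` \<sigma> \<union> snd ` \<sigma>) = 2 * card \<sigma> \<longleftrightarrow>
      card (fst ` \<sigma>) = card \<sigma> \<and> card (snd ` \<sigma>) = card \<sigma>"
    using un le by linarith
  also have "\<dots> \<longleftrightarrow> inj_on fst \<sigma> \<and> inj_on snd \<sigma>"
    by (simp add: inj_on_iff_eq_card fin)
  finally show ?thesis using True by (simp add: matching_faces_def)
qed (simp add: matching_faces_def)

text \<open>Reversing all arrows exchanges tails and heads. With its analogues below, this yields
  attaching tails and exchanging heads from their mirror images.\<close>

lemma swap_complex: "arrow_complex n ((`) prod.swap ` \<Delta>)"
proof -
  note mem = swap_image_mem_iff[where \<Delta> = \<Delta>]
  have sw: "prod.swap a \<in> arrows n \<longleftrightarrow> a \<in> arrows n" for a :: arrow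
    by (cases a) (auto simp: arrows_def)
  have sub: "prod.swap ` \<sigma> \<subseteq> arrows n \<longleftrightarrow> \<sigma> \<subseteq> arrows n" for \<sigma> :: "arrow set"
    unfolding image_subset_iff sw by blast
  show ?thesis
  proof
    show "abstract_complex_on (arrows n) ((`) prod.swap ` \<Delta>)"
      unfolding abstract_complex_on_def
    proof (intro conjI ballI allI impI)
      fix \<sigma> :: "arrow set" assume s: "\<sigma> \<in> (`) prod.swap ` \<Delta>"
      then have s': "prod.swap ` \<sigma> \<in> \<Delta>" by (simp add: mem)
      from face_arrows[OF this] show "\<sigma> \<subseteq> arrows n" by (simp only: sub)
      fix \<tau> assume "\<tau> \<subseteq> \<sigma>"
      then show "\<tau> \<in> (`) prod.swap ` \<Delta>"
        unfolding mem using subface[OF s'] by (simp add: image_mono)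
    next
      fix v :: arrow assume "v \<in> arrows n"
      then show "{v} \<in> (`) prod.swap ` \<Delta>" using vertex_face sw by (simp add: mem)
    qed (simp add: mem empty_face)
  next
    fix \<sigma> :: "arrow set" assume "\<sigma> \<in> (`) prod.swap ` \<Delta>"
    then have "prod.swap ` \<sigma> \<in> \<Delta>" by (simp only: mem)
    from adm[OF this] show "admissible n \<sigma>"
      unfolding admissible_def
    proof (elim exE conjE)
      fix I J assume IJ: "I \<subseteq> {1..n+1}" "J \<subseteq> {1..n+1}" "I \<inter> J = {}" "prod.swap ` \<sigma> \<subseteq> I \<times> J"
      then have "\<sigma> \<subseteq> J \<times> I" by auto
      then show "\<exists>I J. I \<subseteq> {1..n+1} \<and> J \<subseteq> {1..n+1} \<and> I \<inter> J = {} \<and> \<sigma> \<subseteq> I \<times> J"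
        using IJ by (intro exI[of _ J] exI[of _ I]) (simp add: Int_commute)
    qed
  next
    show "flag_complex (arrows n) ((`) prod.swap ` \<Delta>)"
      unfolding flag_complex_def mem
    proof (intro allI impI)
      fix \<sigma> :: "arrow set"
      assume s: "\<sigma> \<subseteq> arrows n" and
        c: "\<forall>a\<in>\<sigma>. \<forall>b\<in>\<sigma>. a \<noteq> b \<longrightarrow> prod.swap ` {a, b} \<in> \<Delta>"
      show "prod.swap ` \<sigma> \<in> \<Delta>"
      proof (rule face_if_pairs)
        fix a b assume "a \<in> prod.swap ` \<sigma>" "b \<in> prod.swap ` \<sigma>" "a \<noteq> b"
        then show "{a, b} \<in> \<Delta>" using c by fastforce
      qed (simp add: sub s)
    qed
  next
    fix i1 j1 i2 j2
    assume "(i1, j1) \<in> arrows n" "(i2, j2) \<in> arrows n" "(i1, j2) \<in> arrows n"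
        "(i2, j1) \<in> arrows n" "i1 \<noteq> i2" "j1 \<noteq> j2"
    then show "({(i1, j1), (i2, j2)} \<in> (`) prod.swap ` \<Delta>) \<noteq>
        ({(i1, j2), (i2, j1)} \<in> (`) prod.swap ` \<Delta>)"
      using exchange[of j1 i1 j2 i2] by (simp add: mem arrows_iff insert_commute)
  qed (simp_all add: mem arrows_iff same_tail same_head)
qed

end

lemma swap_matching_faces:
  "matching_faces ((`) prod.swap ` \<Delta>) = (`) prod.swap ` matching_faces \<Delta>"
proof -
  have "card (prod.swap ` \<sigma>) = card \<sigma>" for \<sigma> :: "arrow set"
    by (rule card_image) (rule inj_on_inverseI[of _ prod.swap], simp)
  then show ?thesis
    by (auto simp: matching_faces_def image_image Un_commute)
qed

section \<open>Extending and joining faces by means of \<open>SA\<close> and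
  \<open>LA\<close>\<close>

locale matching_complex = arrow_complex +
  assumes SA: "SA n (matching_faces \<Delta>)" and LA: "LA n (matching_faces \<Delta>)"
begin

lemma unique_matching:
  assumes "\<sigma> \<in> \<Delta>" "inj_on fst \<sigma>" "inj_on snd \<sigma>"
    and "\<tau> \<in> \<Delta>" "inj_on fst \<tau>" "inj_on snd \<tau>"
    and eq: "fst ` \<sigma> = fst ` \<tau>" "snd ` \<sigma> = snd ` \<tau>"
  shows "\<sigma> = \<tau>"
proof -
  have vert: "fst ` \<sigma> \<subseteq> {1..n+1}" "snd ` \<sigma> \<subseteq> {1..n+1}"
    using face_vertices[OF assms(1)] by auto
  have card: "card (fst ` \<sigma>) = card \<sigma>" "card (snd ` \<sigma>) = card \<sigma>" "card (fst ` \<tau>) = card \<tau>"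
    by (simp_all only: card_image assms(2,3,5))
  have "\<exists>!\<rho>. \<rho> \<in> matching_faces \<Delta> \<and> \<rho> \<subseteq> fst ` \<sigma> \<times> snd ` \<sigma> \<and> card \<rho> = card (fst ` \<sigma>)"
    using SA[unfolded SA_def, rule_format, of "fst ` \<sigma>" "snd ` \<sigma>"]
      vert card tails_heads_disjoint[OF assms(1)] by simp
  moreover have "\<rho> \<subseteq> fst ` \<rho> \<times> snd ` \<rho>" for \<rho> :: "arrow set" by force
  moreover have "\<sigma> \<in> matching_faces \<Delta>" "\<tau> \<in> matching_faces \<Delta>"
    using assms by (simp_all add: matching_faces_iff)
  ultimately show ?thesis using card eq by metis
qed

lemma swap_SA: "SA n (matching_faces ((`) prod.swap ` \<Delta>))"
  unfolding SA_def swap_matching_faces swap_image_mem_iff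
proof (intro allI impI)
  fix I J assume IJ: "I \<subseteq> {1..n+1} \<and> J \<subseteq> {1..n+1} \<and> I \<inter> J = {} \<and> card I = card J"
  then have "\<exists>!\<sigma>. \<sigma> \<in> matching_faces \<Delta> \<and> \<sigma> \<subseteq> J \<times> I \<and> card \<sigma> = card J"
    using SA[unfolded SA_def, rule_format, of J I] by (simp add: Int_commute)
  then obtain \<sigma> where s: "\<sigma> \<in> matching_faces \<Delta>" "\<sigma> \<subseteq> J \<times> I" "card \<sigma> = card J"
    and uniq: "\<And>\<tau>. \<tau> \<in> matching_faces \<Delta> \<Longrightarrow> \<tau> \<subseteq> J \<times> I \<Longrightarrow> card \<tau> = card J \<Longrightarrow> \<tau> = \<sigma>"
    by blast
  have card: "card (prod.swap ` \<tau>) = card \<tau>" for \<tau> :: "arrow set"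
    by (rule card_image) (rule inj_on_inverseI[of _ prod.swap], simp)
  have sub: "prod.swap ` \<tau> \<subseteq> A \<times> B \<longleftrightarrow> \<tau> \<subseteq> B \<times> A" for \<tau> :: "arrow set" and A B
    by (auto simp: image_subset_iff)
  show "\<exists>!\<tau>. prod.swap ` \<tau> \<in> matching_faces \<Delta> \<and> \<tau> \<subseteq> I \<times> J \<and> card \<tau> = card I"
  proof (rule ex1I)
    show "prod.swap ` prod.swap ` \<sigma> \<in> matching_faces \<Delta> \<and> prod.swap ` \<sigma> \<subseteq> I \<times> J \<and>
        card (prod.swap ` \<sigma>) = card I"
      using s IJ by (simp add: card sub image_image)
    fix \<tau> assume "prod.swap ` \<tau> \<in> matching_faces \<Delta> \<and> \<tau> \<subseteq> I \<times> J \<and> card \<tau> = card I"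
    then have "prod.swap ` \<tau> = \<sigma>" using IJ by (intro uniq) (simp_all add: card sub)
    then have "prod.swap ` prod.swap ` \<tau> = prod.swap ` \<sigma>" by (rule arg_cong)
    then show "\<tau> = prod.swap ` \<sigma>" by (simp add: image_image)
  qed
qed

lemma swap_LA: "LA n (matching_faces ((`) prod.swap ` \<Delta>))"
  unfolding LA_def swap_matching_faces swap_image_mem_iff
proof (intro allI impI)
  fix I J and \<sigma> :: "arrow set"
  assume "I \<subseteq> {1..n+1} \<and> J \<subseteq> {1..n+1} \<and> I \<inter> J = {} \<and> prod.swap ` \<sigma> \<in> matching_faces \<Delta> \<and>
    \<sigma> \<noteq> {} \<and> \<sigma> \<subseteq> I \<times> J"
  moreover from this have "prod.swap ` \<sigma> \<subseteq> J \<times> I" by auto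
  ultimately have
    "(\<forall>k\<in>{1..n+1} - (J \<union> I). \<exists>(j, i)\<in>prod.swap ` \<sigma>.
        prod.swap ` \<sigma> - {(j, i)} \<union> {(k, i)} \<in> matching_faces \<Delta>) \<and>
     (\<forall>k\<in>{1..n+1} - (J \<union> I). \<exists>(j, i)\<in>prod.swap ` \<sigma>.
        prod.swap ` \<sigma> - {(j, i)} \<union> {(j, k)} \<in> matching_faces \<Delta>)" (is "?A \<and> ?B")
    using LA[unfolded LA_def, rule_format, of J I "prod.swap ` \<sigma>"] by (simp add: Int_commute)
  moreover have "prod.swap ` (\<sigma> - {(i, j)} \<union> {(k, l)}) = prod.swap ` \<sigma> - {(j, i)} \<union> {(l, k)}"
    for i j k l by force
  moreover have "(\<exists>(j, i)\<in>prod.swap ` \<sigma>. P j i) \<longleftrightarrow> (\<exists>(i, j)\<in>\<sigma>. P j i)" for P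
    by force
  ultimately show
    "(\<forall>k\<in>{1..n+1} - (I \<union> J). \<exists>(i, j)\<in>\<sigma>.
        prod.swap ` (\<sigma> - {(i, j)} \<union> {(k, j)}) \<in> matching_faces \<Delta>) \<and>
     (\<forall>k\<in>{1..n+1} - (I \<union> J). \<exists>(i, j)\<in>\<sigma>.
        prod.swap ` (\<sigma> - {(i, j)} \<union> {(i, k)}) \<in> matching_faces \<Delta>)"
    unfolding Un_commute[of I J] by (subst conj_commute) (simp only: simp_thms)
qed

lemma swap_matching_complex: "matching_complex n ((`) prod.swap ` \<Delta>)"
  by (simp add: matching_complex_def matching_complex_axioms_def swap_complex swap_SA swap_LA)

text \<open>For fixed heads \<open>k\<close> and \<open>h\<close>, \<open>exchange\<close> turns the
  relation "\<open>{(p, k), (q, h)}\<close> is an edge" into a tournament on tails.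
  \<open>LA\<close> for this matching and the new tail \<open>r\<close> yields the desired edge or
  \<open>{(r, k), (q, h)}\<close>, and \<open>exchange\<close> excludes the latter in view of the
  second assumption.\<close>

lemma head_order_trans:
  assumes pq: "{(p, k), (q, h)} \<in> \<Delta>" and qr: "{(q, k), (r, h)} \<in> \<Delta>"
    and ne: "p \<noteq> q" "q \<noteq> r" "p \<noteq> r" "k \<noteq> h" and disj: "p \<noteq> h" "r \<noteq> k"
  shows "{(p, k), (r, h)} \<in> \<Delta>"
proof (rule ccontr)
  assume no: "{(p, k), (r, h)} \<notin> \<Delta>"
  have arr: "(p, k) \<in> arrows n" "(q, h) \<in> arrows n" "(q, k) \<in> arrows n" "(r, h) \<in> arrows n"
    using face_arrows[OF pq] face_arrows[OF qr] by simp_all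
  then have arr': "(p, h) \<in> arrows n" "(r, k) \<in> arrows n"
    using disj by (simp_all add: arrows_iff)
  have "{(p, k), (q, h)} \<in> matching_faces \<Delta>"
    using pq ne by (simp add: matching_faces_iff)
  moreover have "{p, q} \<inter> {k, h} = {}" using arr arr' by (simp add: arrows_iff)
  moreover have "r \<notin> {p, q} \<union> {k, h}" using arr arr' ne by (auto simp: arrows_iff)
  ultimately have "\<exists>(i, j)\<in>{(p, k), (q, h)}.
      {(p, k), (q, h)} - {(i, j)} \<union> {(r, j)} \<in> matching_faces \<Delta>"
    using LA[unfolded LA_def, rule_format, of "{p, q}" "{k, h}" "{(p, k), (q, h)}"] arr arr'
    by (simp add: arrows_iff)
  moreover have "{(p, k), (q, h)} - {(p, k)} = {(q, h)}" "{(p, k), (q, h)} - {(q, h)} = {(p, k)}"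
    using ne by auto
  ultimately have "{(r, k), (q, h)} \<in> \<Delta> \<or> {(r, h), (p, k)} \<in> \<Delta>"
    by (auto simp: matching_faces_iff)
  then show False
    using exchange[of q k r h] qr no arr arr' ne by (auto simp: insert_commute)
qed

text \<open>
  Call \<open>(i, k)\<close> blocked by \<open>(i', j')\<close> if the two are not an edge. If every \<open>(i, k)\<close> were blocked
  by an arrow of \<open>\<sigma>\<close>, a minimal set of tails closed under blocking would carry a matching of blocking
  arrows, and \<open>k\<close> would violate \<open>LA\<close> for that matching.
\<close>

lemma attach_head:
  assumes s: "\<sigma> \<in> \<Delta>" "\<sigma> \<noteq> {}" and k: "k \<in> {1..n+1}" "k \<notin> fst ` \<sigma>" "k \<notin> snd ` \<sigma>"
  obtains i where "i \<in> fst ` \<sigma>" "insert (i, k) \<sigma> \<in> \<Delta>"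
proof (rule ccontr)
  assume "\<not> thesis"
  then have none: "insert (i, k) \<sigma> \<notin> \<Delta>" if "i \<in> fst ` \<sigma>" for i
    using that \<open>\<And>i. i \<in> fst ` \<sigma> \<Longrightarrow> insert (i, k) \<sigma> \<in> \<Delta> \<Longrightarrow> thesis\<close> by blast
  note arr = face_arrows[OF s(1)]
  define R where "R i i' \<longleftrightarrow> (\<exists>j'. (i', j') \<in> \<sigma> \<and> {(i, k), (i', j')} \<notin> \<Delta>)" for i i'
  have ik: "(i, k) \<in> arrows n" if "i \<in> fst ` \<sigma>" for i
    using that k arr by (auto simp: arrows_def)
  have Rne: "i \<noteq> i'" if "R i i'" "i \<in> fst ` \<sigma>" for i i'
    using that ik same_tail arr unfolding R_def by blast
  have "\<exists>i'\<in>fst ` \<sigma>. R i i'" if "i \<in> fst ` \<sigma>" for i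
  proof (rule ccontr)
    assume c: "\<not> ?thesis"
    have "insert (i, k) \<sigma> \<in> \<Delta>"
    proof (rule insert_face)
      fix b assume b: "b \<in> \<sigma>"
      then have "fst b \<in> fst ` \<sigma>" by blast
      then show "{(i, k), b} \<in> \<Delta>" using b c by (cases b) (auto simp: R_def)
    qed (use s ik that in auto)
    then show False using none that by blast
  qed
  then obtain B f where B: "B \<subseteq> fst ` \<sigma>" "B \<noteq> {}" "bij_betw f B B"
    and f: "\<And>a b. a \<in> B \<Longrightarrow> b \<in> B \<Longrightarrow> R a b \<longleftrightarrow> b = f a"
    using serial_relation_core[of "fst ` \<sigma>" R] finite_face[OF s(1)] s(2) by auto
  have fB: "f i \<in> B" if "i \<in> B" for i using B(3) that by (auto simp: bij_betw_def)
  have "\<forall>i\<in>B. \<exists>j'. (f i, j') \<in> \<sigma> \<and> {(i, k), (f i, j')} \<notin> \<Delta>"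
    using f fB by (simp add: R_def)
  then obtain g where g: "\<And>i. i \<in> B \<Longrightarrow> (f i, g i) \<in> \<sigma> \<and> {(i, k), (f i, g i)} \<notin> \<Delta>"
    using bchoice by meson
  \<comment> \<open>Suppose two blocking arrows had the same head \<open>h\<close>. In the order of
    \<open>head_order_trans\<close>, blocking puts \<open>f i\<close> below \<open>i\<close> and
    \<open>f i'\<close> below \<open>i'\<close>. Within \<open>B\<close> only \<open>f i\<close> is
    related to \<open>i\<close>, so \<open>i\<close> is below or equal to \<open>f i'\<close>, and
    likewise \<open>i'\<close> to \<open>f i\<close>: a cycle.\<close>
  have inj: "inj_on g B"
  proof (rule inj_onI, rule ccontr)
    fix i i' assume i: "i \<in> B" "i' \<in> B" "g i = g i'" "i \<noteq> i'"
    define h where "h = g i"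
    define less where "less p q \<longleftrightarrow> {(p, k), (q, h)} \<in> \<Delta>" for p q
    have fi: "(f i, h) \<in> \<sigma>" "(f i', h) \<in> \<sigma>" "\<not> less i (f i)" "\<not> less i' (f i')"
      using g[OF i(1)] g[OF i(2)] i(3) by (simp_all add: h_def less_def)
    have hk: "h \<noteq> k" using fi(1) k by force
    have hN: "h \<noteq> p" if "p \<in> B" for p
      using tails_heads_disjoint[OF s(1)] fi(1) that B(1) by force
    have ph: "(p, h) \<in> arrows n" if "p \<in> B" for p
      using hN[OF that] ik that B(1) fi(1) arr by (force simp: arrows_def)
    have pk: "(p, k) \<in> arrows n" if "p \<in> B" for p using ik that B(1) by blast
    have total: "less p q \<longleftrightarrow> \<not> less q p" if "p \<in> B" "q \<in> B" "p \<noteq> q" for p q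
      using exchange[of p k q h] that ph pk hk by (auto simp: less_def insert_commute)
    have trans: "less p r" if "less p q" "less q r" "p \<in> B" "q \<in> B" "r \<in> B" for p q r
    proof (cases "p = q \<or> q = r \<or> p = r")
      case True
      then show ?thesis
      proof (elim disjE)
        assume "p = r"
        show ?thesis
        proof (cases "p = q")
          case False
          then show ?thesis using total[of p q] that \<open>p = r\<close> by simp
        qed (use that in simp)
      qed (use that in simp_all)
    next
      case False
      then show ?thesis unfolding less_def
        by (intro head_order_trans[of p k q h r])
          (use that hN hk pk in \<open>auto simp: less_def arrows_iff\<close>)
    qed
    have fne: "f i \<noteq> i" "f i' \<noteq> i'" "f i \<noteq> f i'"
    proof -
      have "R i (f i)" "R i' (f i')" using f[of i] f[of i'] fB i(1,2) by simp_all
      then show "f i \<noteq> i" "f i' \<noteq> i'" using Rne B(1) i(1,2) by fastforce+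
      show "f i \<noteq> f i'" using bij_betw_imp_inj_on[OF B(3)] i(1,2,4) by (simp add: inj_on_eq_iff)
    qed
    have down: "less (f i) i" "less (f i') i'"
      using total[OF fB[OF i(1)] i(1)] total[OF fB[OF i(2)] i(2)] fi(3,4) fne by simp_all
    have "less i (f i')" if "i \<noteq> f i'"
    proof -
      have "\<not> R i (f i')" using f[OF i(1) fB[OF i(2)]] fne by simp
      then show ?thesis using fi by (auto simp: R_def less_def)
    qed
    moreover have "less i' (f i)" if "i' \<noteq> f i"
    proof -
      have "\<not> R i' (f i)" using f[OF i(2) fB[OF i(1)]] fne by simp
      then show ?thesis using fi by (auto simp: R_def less_def)
    qed
    ultimately have "less (f i) (f i')" "less (f i') (f i)"
      using down trans[OF down(1), of "f i'"] trans[OF down(2), of "f i"] fB i(1,2) by metis+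
    then show False using total[OF fB[OF i(1)] fB[OF i(2)] fne(3)] by simp
  qed
  define m where "m = (\<lambda>i. (f i, g i)) ` B"
  have "m \<subseteq> \<sigma>" using g by (auto simp: m_def)
  then have mD: "m \<in> \<Delta>" using s subface by blast
  have injf: "inj_on f B" using B(3) by (rule bij_betw_imp_inj_on)
  have "m \<in> matching_faces \<Delta>"
    using mD injf inj by (auto simp: matching_faces_iff m_def inj_on_def)
  moreover have "m \<noteq> {}" using B by (simp add: m_def)
  moreover have "m \<subseteq> fst ` m \<times> snd ` m" by force
  moreover have "fst ` m \<subseteq> {1..n+1}" "snd ` m \<subseteq> {1..n+1}" using face_vertices[OF mD] by auto
  moreover have "k \<in> {1..n+1} - (fst ` m \<union> snd ` m)" using k \<open>m \<subseteq> \<sigma>\<close> by blast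
  ultimately have "\<exists>(i, j)\<in>m. m - {(i, j)} \<union> {(i, k)} \<in> matching_faces \<Delta>"
    using LA[unfolded LA_def, rule_format, of "fst ` m" "snd ` m" m] tails_heads_disjoint[OF mD]
    by blast
  \<comment> \<open>The removed arrow has its tail \<open>i\<close> in \<open>B\<close>, and the
    arrow of \<open>m\<close> that blocks \<open>(i, k)\<close> has the different tail
    \<open>f i\<close>. So it survives in one face with \<open>(i, k)\<close>.\<close>
  then obtain i j where ij: "(i, j) \<in> m" "m - {(i, j)} \<union> {(i, k)} \<in> \<Delta>"
    by (auto simp: matching_faces_iff)
  then have iB: "i \<in> B" using fB by (auto simp: m_def)
  then have "R i (f i)" using f[of i] fB by simp
  then have "f i \<noteq> i" using Rne iB B(1) by fastforce
  then have "(f i, g i) \<in> m - {(i, j)}" using iB by (auto simp: m_def)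
  then have "{(i, k), (f i, g i)} \<in> \<Delta>" by (intro pair_face[OF ij(2)]) auto
  then show False using g[OF iB] by blast
qed

text \<open>Heads are attached one at a time. This never creates a new tail, so every new arrow
  starts at a tail of the original face.\<close>

lemma attach_heads:
  assumes s: "\<sigma> \<in> \<Delta>" "\<sigma> \<noteq> {}" and K: "finite K" "K \<subseteq> {1..n+1}" "K \<inter> (fst ` \<sigma> \<union> snd ` \<sigma>) = {}"
  obtains \<alpha> where "\<alpha> ` K \<subseteq> fst ` \<sigma>" "\<sigma> \<union> (\<lambda>k. (\<alpha> k, k)) ` K \<in> \<Delta>"
proof -
  have "\<exists>\<alpha>. \<alpha> ` K \<subseteq> fst ` \<sigma> \<and> \<sigma> \<union> (\<lambda>k. (\<alpha> k, k)) ` K \<in> \<Delta>"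
    using K
  proof (induction K)
    case empty
    then show ?case using s by simp
  next
    case (insert k K)
    then obtain \<alpha> where \<alpha>: "\<alpha> ` K \<subseteq> fst ` \<sigma>" "\<sigma> \<union> (\<lambda>k. (\<alpha> k, k)) ` K \<in> \<Delta>" by auto
    let ?\<tau> = "\<sigma> \<union> (\<lambda>k. (\<alpha> k, k)) ` K"
    have tails: "fst ` ?\<tau> = fst ` \<sigma>" and heads: "snd ` ?\<tau> = snd ` \<sigma> \<union> K"
      using \<alpha>(1) by (auto simp: image_Un image_image)
    obtain i where i: "i \<in> fst ` \<sigma>" "insert (i, k) ?\<tau> \<in> \<Delta>"
      by (rule attach_head[of ?\<tau> k, unfolded tails heads]) (use \<alpha>(2) s insert in auto)
    have "(\<lambda>l. ((\<alpha>(k := i)) l, l)) ` insert k K = insert (i, k) ((\<lambda>k. (\<alpha> k, k)) ` K)"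
      using insert.hyps(2) by (auto intro!: image_eqI)
    then have "\<sigma> \<union> (\<lambda>l. ((\<alpha>(k := i)) l, l)) ` insert k K \<in> \<Delta>"
      using i(2) by (simp only: Un_insert_right)
    moreover have "(\<alpha>(k := i)) ` insert k K \<subseteq> fst ` \<sigma>" using \<alpha>(1) i(1) by auto
    ultimately show ?case by blast
  qed
  then show ?thesis using that by blast
qed

lemma attach_tails:
  assumes s: "\<sigma> \<in> \<Delta>" "\<sigma> \<noteq> {}" and K: "finite K" "K \<subseteq> {1..n+1}" "K \<inter> (fst ` \<sigma> \<union> snd ` \<sigma>) = {}"
  obtains \<beta> where "\<beta> ` K \<subseteq> snd ` \<sigma>" "\<sigma> \<union> (\<lambda>k. (k, \<beta> k)) ` K \<in> \<Delta>"
proof -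
  interpret sw: matching_complex n "(`) prod.swap ` \<Delta>" by (rule swap_matching_complex)
  have im: "fst ` prod.swap ` \<sigma> = snd ` \<sigma>" "snd ` prod.swap ` \<sigma> = fst ` \<sigma>"
    by (simp_all add: image_image)
  obtain \<beta> where "\<beta> ` K \<subseteq> fst ` prod.swap ` \<sigma>"
    "prod.swap ` \<sigma> \<union> (\<lambda>k. (\<beta> k, k)) ` K \<in> (`) prod.swap ` \<Delta>"
    by (rule sw.attach_heads[of "prod.swap ` \<sigma>" K])
      (use s K im in \<open>auto simp: swap_image_mem_iff image_image Un_commute\<close>)
  then show ?thesis
    using that[of \<beta>] by (simp add: swap_image_mem_iff im image_image image_Un)
qed

text \<open>
  Attach all heads of \<open>\<tau>\<close> to \<open>\<sigma>\<close> and all tails of \<open>\<sigma>\<close> to \<open>\<tau>\<close>. If no connecting arrow occurred on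
  both sides, the two families would contain distinct matchings with the same tails and heads.
\<close>

lemma connecting_arrow:
  assumes s: "\<sigma> \<in> \<Delta>" "\<sigma> \<noteq> {}" and t: "\<tau> \<in> \<Delta>" "\<tau> \<noteq> {}" and un: "\<sigma> \<union> \<tau> \<in> \<Delta>"
    and disj: "(fst ` \<sigma> \<union> snd ` \<sigma>) \<inter> (fst ` \<tau> \<union> snd ` \<tau>) = {}"
  obtains i j where "i \<in> fst ` \<sigma>" "j \<in> snd ` \<tau>" "insert (i, j) (\<sigma> \<union> \<tau>) \<in> \<Delta>"
proof -
  obtain \<alpha> where \<alpha>: "\<alpha> ` snd ` \<tau> \<subseteq> fst ` \<sigma>" "\<sigma> \<union> (\<lambda>k. (\<alpha> k, k)) ` snd ` \<tau> \<in> \<Delta>"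
    by (rule attach_heads[OF s, of "snd ` \<tau>"])
      (use finite_face[OF t(1)] face_vertices[OF t(1)] disj in auto)
  obtain \<beta> where \<beta>: "\<beta> ` fst ` \<sigma> \<subseteq> snd ` \<tau>" "\<tau> \<union> (\<lambda>k. (k, \<beta> k)) ` fst ` \<sigma> \<in> \<Delta>"
    by (rule attach_tails[OF t, of "fst ` \<sigma>"])
      (use finite_face[OF s(1)] face_vertices[OF s(1)] disj in auto)
  define f where "f = \<alpha> \<circ> \<beta>"
  have "f ` fst ` \<sigma> \<subseteq> fst ` \<sigma>"
    using \<alpha>(1) \<beta>(1) unfolding f_def image_comp[symmetric] by blast
  then obtain B where B: "B \<subseteq> fst ` \<sigma>" "B \<noteq> {}" "f ` B = B" "inj_on f B"
    using finite_self_map_core[of "fst ` \<sigma>" f] finite_face[OF s(1)] s(2) by auto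
  have inj: "inj_on \<beta> B" using B(4) unfolding f_def by (rule inj_on_imageI2)
  \<comment> \<open>As \<open>f\<close> permutes \<open>B\<close>, the arrows \<open>m\<close> from
    the enlargement of \<open>\<tau>\<close> and the arrows \<open>m'\<close> from the enlargement
    of \<open>\<sigma>\<close> are matchings with the same tails, namely \<open>B\<close>, and the
    same heads.\<close>
  define m where "m = (\<lambda>i. (i, \<beta> i)) ` B"
  define m' where "m' = (\<lambda>i. (f i, \<beta> i)) ` B"
  have \<beta>B: "\<beta> i \<in> snd ` \<tau>" if "i \<in> B" for i using \<beta>(1) B(1) that by blast
  have "m \<in> \<Delta>" by (rule subface[OF \<beta>(2)]) (use B(1) in \<open>auto simp: m_def\<close>)
  moreover have "m' \<in> \<Delta>" by (rule subface[OF \<alpha>(2)]) (use \<beta>B in \<open>auto simp: m'_def f_def\<close>)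
  moreover have "inj_on fst m" "inj_on snd m" "inj_on fst m'" "inj_on snd m'"
    using inj B(4) by (auto simp: inj_on_def m_def m'_def)
  moreover have "fst ` m = fst ` m'" "snd ` m = snd ` m'"
    using B(3) by (simp_all add: m_def m'_def image_image)
  ultimately have mm: "m = m'" by (intro unique_matching)
  obtain i where i: "i \<in> B" using B(2) by blast
  then have "(i, \<beta> i) \<in> m'" using mm by (auto simp: m_def)
  then obtain i' where "i' \<in> B" "i = f i'" "\<beta> i = \<beta> i'" by (auto simp: m'_def)
  \<comment> \<open>So \<open>\<alpha>\<close> leads from \<open>\<beta> i\<close> back to
    \<open>i\<close>: the arrow \<open>(i, \<beta> i)\<close> lies in both enlarged faces and forms
    an edge with every arrow of \<open>\<sigma>\<close> and of \<open>\<tau>\<close>.\<close>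
  then have fi: "f i = i" by (simp add: f_def)
  have "(i, \<beta> i) \<in> (\<lambda>k. (\<alpha> k, k)) ` snd ` \<tau>"
    by (rule image_eqI[of _ _ "\<beta> i"]) (use \<beta>B[OF i] fi in \<open>simp_all add: f_def\<close>)
  moreover have "(i, \<beta> i) \<in> (\<lambda>k. (k, \<beta> k)) ` fst ` \<sigma>"
    using i B(1) by blast
  ultimately have i\<beta>: "(i, \<beta> i) \<in> \<sigma> \<union> (\<lambda>k. (\<alpha> k, k)) ` snd ` \<tau>"
    "(i, \<beta> i) \<in> \<tau> \<union> (\<lambda>k. (k, \<beta> k)) ` fst ` \<sigma>" by auto
  have "insert (i, \<beta> i) (\<sigma> \<union> \<tau>) \<in> \<Delta>"
  proof (rule insert_face[OF un])
    show "(i, \<beta> i) \<in> arrows n" using face_arrows[OF \<beta>(2)] i\<beta>(2) by (rule subsetD)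
    fix b assume "b \<in> \<sigma> \<union> \<tau>"
    then show "{(i, \<beta> i), b} \<in> \<Delta>"
      using pair_face[OF \<alpha>(2) i\<beta>(1)] pair_face[OF \<beta>(2) i\<beta>(2)] by blast
  qed
  then show ?thesis using that[of i "\<beta> i"] i B(1) \<beta>B by blast
qed

text \<open>Arrows with a common tail are pairwise edges, so flagness makes the star a face; the
  other tails are attached as leaves. The result is a spanning tree on \<open>I \<union> J\<close>,
  whose cone will serve as a full-dimensional start in the cell of \<open>I\<close> and
  \<open>J\<close>.\<close>

lemma star_with_leaves:
  assumes IJ: "I \<subseteq> {1..n+1}" "J \<subseteq> {1..n+1}" "I \<inter> J = {}" "J \<noteq> {}" and i0: "i0 \<in> I"
  obtains \<beta> where "\<beta> ` (I - {i0}) \<subseteq> J" "{i0} \<times> J \<union> (\<lambda>k. (k, \<beta> k)) ` (I - {i0}) \<in> \<Delta>"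
proof -
  have star: "{i0} \<times> J \<in> \<Delta>"
  proof (rule face_if_pairs)
    have "(i0, j) \<in> arrows n" if "j \<in> J" for j
      unfolding arrows_iff using IJ i0 that by blast
    then show sub: "{i0} \<times> J \<subseteq> arrows n" by blast
    fix a b assume "a \<in> {i0} \<times> J" "b \<in> {i0} \<times> J"
    then show "{a, b} \<in> \<Delta>" using same_tail[of i0 "snd a" "snd b"] sub by fastforce
  qed
  have fin: "finite I" using IJ(1) finite_subset by blast
  obtain \<beta> where "\<beta> ` (I - {i0}) \<subseteq> snd ` ({i0} \<times> J)"
    "{i0} \<times> J \<union> (\<lambda>k. (k, \<beta> k)) ` (I - {i0}) \<in> \<Delta>"
    by (rule attach_tails[OF star, of "I - {i0}"])
      (use IJ fin in auto)
  then show ?thesis using that[of \<beta>] by auto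
qed

end

section \<open>Arrow vectors\<close>

definition vertices :: "nat \<Rightarrow> nat set" where
  "vertices n = {1..n+1}"

lemma finite_vertices: "finite (vertices n)"
  by (simp add: vertices_def)

lemma arrow_ends:
  assumes "a \<in> arrows n"
  shows "fst a \<in> vertices n" "snd a \<in> vertices n" "fst a \<noteq> snd a"
  using assms by (auto simp: arrows_def vertices_def)

text \<open>Stated through inner products so that the negated basis is again a frame; this is how
  reversing arrows acts on points in \<open>swap_triangulated\<close>.\<close>

locale orthonormal_frame =
  fixes n :: nat and e :: "nat \<Rightarrow> 'v::euclidean_space"
  assumes orth: "\<lbrakk>u \<in> vertices n; v \<in> vertices n\<rbrakk> \<Longrightarrow> e u \<bullet> e v = (if u = v then 1 else 0)"
begin

abbreviation V :: "arrow \<Rightarrow> 'v" where "V \<equiv> arrow_vertex e"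

lemma V_pair: "V (i, j) = e j - e i"
  by (simp add: arrow_vertex_def)

lemma V_coord:
  assumes "a \<in> arrows n" "v \<in> vertices n"
  shows "V a \<bullet> e v = of_bool (snd a = v) - of_bool (fst a = v)"
  by (simp add: arrow_vertex_def split_def inner_diff_left orth assms(2) arrow_ends[OF assms(1)])

text \<open>With \<open>w\<close> read as a flow along the arrows, the coordinates of this vector
  are the net inflows at the vertices.\<close>

definition comb :: "(arrow \<Rightarrow> real) \<Rightarrow> 'v" where
  "comb w = (\<Sum>a\<in>arrows n. w a *\<^sub>R V a)"

definition supp :: "(arrow \<Rightarrow> real) \<Rightarrow> arrow set" where
  "supp w = {a \<in> arrows n. w a \<noteq> 0}"

lemma comb_coord:
  assumes "v \<in> vertices n"
  shows "comb w \<bullet> e v = (\<Sum>a\<in>{a \<in> arrows n. snd a = v}. w a) - (\<Sum>a\<in>{a \<in> arrows n. fst a = v}. w a)"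
proof -
  have "comb w \<bullet> e v = (\<Sum>a\<in>arrows n. w a * (of_bool (snd a = v) - of_bool (fst a = v)))"
    unfolding comb_def inner_sum_left by (intro sum.cong refl) (simp only: inner_scaleR_left V_coord[OF _ assms])
  also have "\<dots> = (\<Sum>a\<in>arrows n. if snd a = v then w a else 0) -
      (\<Sum>a\<in>arrows n. if fst a = v then w a else 0)"
    unfolding sum_subtractf[symmetric] by (intro sum.cong refl) simp
  finally show ?thesis using finite_arrows by (simp add: sum.inter_filter)
qed

lemma comb_restrict:
  "\<sigma> \<subseteq> arrows n \<Longrightarrow> comb (\<lambda>a. if a \<in> \<sigma> then w a else 0) = (\<Sum>a\<in>\<sigma>. w a *\<^sub>R V a)"
  unfolding comb_def using finite_arrows
  by (intro sum.mono_neutral_cong_right) auto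

lemma comb_supp: "comb w = (\<Sum>a\<in>supp w. w a *\<^sub>R V a)"
  unfolding comb_def supp_def using finite_arrows by (intro sum.mono_neutral_right) auto

lemma comb_coord_supp:
  assumes "v \<in> vertices n"
  shows "comb w \<bullet> e v = (\<Sum>a\<in>{a \<in> supp w. snd a = v}. w a) - (\<Sum>a\<in>{a \<in> supp w. fst a = v}. w a)"
proof -
  have "(\<Sum>a\<in>{a \<in> arrows n. P a}. w a) = (\<Sum>a\<in>{a \<in> supp w. P a}. w a)" for P
    using finite_arrows by (intro sum.mono_neutral_right) (auto simp: supp_def)
  then show ?thesis by (simp only: comb_coord[OF assms])
qed

lemma inj_V: "inj_on V (arrows n)"
proof (rule inj_onI)
  fix a b assume a: "a \<in> arrows n" and b: "b \<in> arrows n" and eq: "V a = V b"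
  note ends = arrow_ends[OF a]
  have "V b \<bullet> e (snd a) = 1" "V b \<bullet> e (fst a) = -1"
    unfolding eq[symmetric] using ends by (simp_all add: V_coord[OF a])
  then have "snd a = snd b" "fst a = fst b"
    using V_coord[OF b ends(1)] V_coord[OF b ends(2)] by (auto simp: of_bool_def split: if_splits)
  then show "a = b" by (simp add: prod_eq_iff)
qed

text \<open>An arrow vector has one coordinate 1 and one coordinate -1, hence norm 2; this is the
  origin of the constant 2 that marks the boundary.\<close>

definition l1 :: "'v \<Rightarrow> real" where
  "l1 x = (\<Sum>v\<in>vertices n. \<bar>x \<bullet> e v\<bar>)"

definition H :: "'v set" where
  "H = span (V ` arrows n)"

lemma H_coord_sum:
  assumes "x \<in> H"
  shows "(\<Sum>v\<in>vertices n. x \<bullet> e v) = 0"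
  using assms unfolding H_def
proof (induction rule: span_induct)
  case base
  show ?case by (simp add: subspace_def inner_add_left sum.distrib flip: sum_distrib_left)
next
  case (step x)
  then obtain a where a: "a \<in> arrows n" "x = V a" by blast
  note f = arrow_ends[OF a(1)]
  have "(\<Sum>v\<in>vertices n. V a \<bullet> e v) = (\<Sum>v\<in>vertices n. of_bool (snd a = v) - of_bool (fst a = v))"
    by (intro sum.cong refl V_coord a)
  also have "\<dots> = 0"
    using f by (simp only: sum_subtractf of_bool_def sum.delta' finite_vertices if_True)
  finally show ?case using a by simp
qed

lemma H_expansion:
  assumes "x \<in> H"
  shows "x = (\<Sum>v\<in>vertices n. (x \<bullet> e v) *\<^sub>R e v)"
  using assms unfolding H_def
proof (induction rule: span_induct)
  case base
  show ?case
    by (simp add: subspace_def inner_add_left sum.distrib scaleR_add_left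
        flip: scaleR_scaleR scaleR_sum_right)
next
  case (step x)
  then obtain a where a: "a \<in> arrows n" "x = V a" by blast
  note f = arrow_ends[OF a(1)]
  have "(\<Sum>v\<in>vertices n. (V a \<bullet> e v) *\<^sub>R e v) =
      (\<Sum>v\<in>vertices n. (if snd a = v then e v else 0) - (if fst a = v then e v else 0))"
    by (intro sum.cong refl) (simp add: V_coord a)
  also have "\<dots> = V a"
    using f by (simp only: sum_subtractf sum.delta' finite_vertices if_True)
      (simp add: arrow_vertex_def split_def)
  finally show ?case using a by simp
qed

lemma comb_in_H: "comb w \<in> H"
  unfolding comb_def H_def by (intro span_sum span_scale span_base) auto

lemma l1_scale: "l1 (c *\<^sub>R x) = \<bar>c\<bar> * l1 x"
  by (simp add: l1_def abs_mult sum_distrib_left)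

lemma l1_le_2: "x \<in> root_polytope n e \<Longrightarrow> l1 x \<le> 2"
proof -
  have conv: "convex {x. l1 x \<le> 2}"
  proof (rule convexI, simp)
    fix x y and u v :: real
    assume xy: "l1 x \<le> 2" "l1 y \<le> 2" and uv: "0 \<le> u" "0 \<le> v" "u + v = 1"
    have "l1 (u *\<^sub>R x + v *\<^sub>R y) \<le> u * l1 x + v * l1 y"
      unfolding l1_def sum_distrib_left sum.distrib[symmetric]
      by (intro sum_mono order.trans[OF abs_triangle_ineq])
        (simp add: inner_add_left abs_mult uv order.trans[OF abs_triangle_ineq])
    also have "\<dots> \<le> u * 2 + v * 2" using xy uv by (intro add_mono mult_left_mono) auto
    finally show "l1 (u *\<^sub>R x + v *\<^sub>R y) \<le> 2" using uv by simp
  qed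
  have "l1 (V a) \<le> 2" if a: "a \<in> arrows n" for a
  proof -
    note f = arrow_ends[OF a]
    have "l1 (V a) \<le> (\<Sum>v\<in>vertices n. of_bool (snd a = v) + of_bool (fst a = v))"
      unfolding l1_def by (intro sum_mono) (simp add: V_coord a)
    also have "\<dots> = 2"
      using f by (simp only: sum.distrib of_bool_def sum.delta' finite_vertices if_True)
    finally show ?thesis .
  qed
  then have "root_polytope n e \<subseteq> {x. l1 x \<le> 2}"
    unfolding root_polytope_def using conv by (intro hull_minimal) auto
  then show "x \<in> root_polytope n e \<Longrightarrow> l1 x \<le> 2" by blast
qed

lemma root_polytope_subset_H: "root_polytope n e \<subseteq> H"
  unfolding root_polytope_def H_def by (rule convex_hull_subset_span)

text \<open>Under this condition inflow and outflow never meet at a vertex, so there is no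
  cancellation. It is kept apart from \<open>face_weights\<close> because the barycentre of an
  arbitrary bijection also satisfies it.\<close>

definition bipartite_weights :: "(arrow \<Rightarrow> real) \<Rightarrow> bool" where
  "bipartite_weights w \<longleftrightarrow> fst ` supp w \<inter> snd ` supp w = {} \<and> (\<forall>a\<in>arrows n. 0 \<le> w a)"

lemma
  assumes w: "bipartite_weights w"
  shows comb_tail: "a \<in> supp w \<Longrightarrow> comb w \<bullet> e (fst a) = - (\<Sum>b\<in>{b \<in> supp w. fst b = fst a}. w b)"
    and comb_head: "a \<in> supp w \<Longrightarrow> comb w \<bullet> e (snd a) = (\<Sum>b\<in>{b \<in> supp w. snd b = snd a}. w b)"
    and comb_tail_neg: "a \<in> supp w \<Longrightarrow> comb w \<bullet> e (fst a) < 0"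
    and comb_head_pos: "a \<in> supp w \<Longrightarrow> comb w \<bullet> e (snd a) > 0"
proof -
  have fin: "finite (supp w)" using finite_arrows by (simp add: supp_def)
  have pos: "w b > 0" if "b \<in> supp w" for b
    using that w by (fastforce simp: supp_def bipartite_weights_def order.order_iff_strict)
  assume a: "a \<in> supp w"
  then have ends: "fst a \<in> vertices n" "snd a \<in> vertices n"
    using arrow_ends by (auto simp: supp_def)
  have no: "{b \<in> supp w. snd b = fst a} = {}" "{b \<in> supp w. fst b = snd a} = {}"
    using w a unfolding bipartite_weights_def by (blast, blast)
  show t: "comb w \<bullet> e (fst a) = - (\<Sum>b\<in>{b \<in> supp w. fst b = fst a}. w b)"
    by (simp only: comb_coord_supp[OF ends(1)] no) simp
  show h: "comb w \<bullet> e (snd a) = (\<Sum>b\<in>{b \<in> supp w. snd b = snd a}. w b)"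
    by (simp only: comb_coord_supp[OF ends(2)] no) simp
  have "(\<Sum>b\<in>{b \<in> supp w. fst b = fst a}. w b) > 0" "(\<Sum>b\<in>{b \<in> supp w. snd b = snd a}. w b) > 0"
    using a fin pos by (auto intro!: sum_pos)
  then show "comb w \<bullet> e (fst a) < 0" "comb w \<bullet> e (snd a) > 0" by (simp_all add: t h)
qed

text \<open>For disjoint nonempty sets of vertices \<open>I\<close> and \<open>J\<close> this is the
  relatively open cone over the face of the root polytope spanned by the arrows in
  \<open>I \<times> J\<close>.\<close>

definition sign_pattern :: "nat set \<Rightarrow> nat set \<Rightarrow> 'v \<Rightarrow> bool" where
  "sign_pattern I J x \<longleftrightarrow> x \<in> H \<and>
     (\<forall>v\<in>vertices n. (x \<bullet> e v < 0 \<longleftrightarrow> v \<in> I) \<and> (x \<bullet> e v > 0 \<longleftrightarrow> v \<in> J))"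

text \<open>Tails have negative and heads positive coordinates; conversely a negative coordinate
  needs a departing arrow and a positive one an arriving arrow. Hence all representations of points
  of one cell have the same tails and heads, if not the same arrows.\<close>

lemma supp_sign_pattern:
  assumes w: "bipartite_weights w" and s: "sign_pattern I J (comb w)" "I \<subseteq> vertices n" "J \<subseteq> vertices n"
  shows "supp w \<subseteq> I \<times> J" "fst ` supp w = I" "snd ` supp w = J"
proof -
  have ends: "fst a \<in> vertices n" "snd a \<in> vertices n" if "a \<in> supp w" for a
    using that arrow_ends by (auto simp: supp_def)
  have mem: "fst a \<in> I \<and> snd a \<in> J" if "a \<in> supp w" for a
    using comb_tail_neg[OF w that] comb_head_pos[OF w that] s(1) ends[OF that]
    by (simp add: sign_pattern_def)
  then show "supp w \<subseteq> I \<times> J" by force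
  have nonneg: "0 \<le> w b" if "b \<in> supp w" for b
    using w that by (auto simp: bipartite_weights_def supp_def)
  show "fst ` supp w = I"
  proof (intro equalityI subsetI)
    fix v assume v: "v \<in> I"
    then have vn: "v \<in> vertices n" using s(2) by blast
    show "v \<in> fst ` supp w"
    proof (rule ccontr)
      assume no: "v \<notin> fst ` supp w"
      then have em: "{b \<in> supp w. fst b = v} = {}" by blast
      have "comb w \<bullet> e v \<ge> 0"
        unfolding comb_coord_supp[OF vn] em using nonneg by (auto intro: sum_nonneg)
      then show False using v vn s(1) by (auto simp: sign_pattern_def)
    qed
  qed (use mem in auto)
  show "snd ` supp w = J"
  proof (intro equalityI subsetI)
    fix v assume v: "v \<in> J"
    then have vn: "v \<in> vertices n" using s(3) by blast
    show "v \<in> snd ` supp w"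
    proof (rule ccontr)
      assume no: "v \<notin> snd ` supp w"
      then have em: "{b \<in> supp w. snd b = v} = {}" by blast
      have "comb w \<bullet> e v \<le> 0"
        unfolding comb_coord_supp[OF vn] em using nonneg by (auto intro: sum_nonneg)
      then show False using v vn s(1) by (auto simp: sign_pattern_def)
    qed
  qed (use mem in auto)
qed

lemma comb_sign_pattern:
  assumes w: "bipartite_weights w"
  shows "sign_pattern (fst ` supp w) (snd ` supp w) (comb w)"
  unfolding sign_pattern_def
proof (intro conjI ballI)
  fix v assume v: "v \<in> vertices n"
  have tail: "comb w \<bullet> e v < 0" if "v \<in> fst ` supp w"
    using that comb_tail_neg[OF w] by auto
  have head: "comb w \<bullet> e v > 0" if "v \<in> snd ` supp w"
    using that comb_head_pos[OF w] by auto
  have zero: "comb w \<bullet> e v = 0" if "v \<notin> fst ` supp w" "v \<notin> snd ` supp w"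
  proof -
    have "{a \<in> supp w. fst a = v} = {}" "{a \<in> supp w. snd a = v} = {}" using that by blast+
    then show ?thesis by (simp only: comb_coord_supp[OF v])
  qed
  show "(comb w \<bullet> e v < 0) = (v \<in> fst ` supp w)" "(comb w \<bullet> e v > 0) = (v \<in> snd ` supp w)"
    using tail head zero by fastforce+
qed (rule comb_in_H)

lemma sign_pattern_convex:
  assumes "sign_pattern I J x" "sign_pattern I J y" "0 \<le> t" "t \<le> 1"
  shows "sign_pattern I J (x + t *\<^sub>R (y - x))"
proof -
  have eq: "x + t *\<^sub>R (y - x) = (1 - t) *\<^sub>R x + t *\<^sub>R y" by (simp add: algebra_simps)
  have H: "(1 - t) *\<^sub>R x + t *\<^sub>R y \<in> H"
    using assms(1,2) unfolding sign_pattern_def H_def by (intro span_add span_scale) auto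
  have neg: "(1 - t) * a + t * b < 0" if "a < 0" "b < 0" for a b :: real
    using convex_bound_lt[of a 0 b "1 - t" t] that assms(3,4) by simp
  have pos: "(1 - t) * a + t * b > 0" if "a > 0" "b > 0" for a b :: real
    using neg[of "- a" "- b"] that by simp
  show ?thesis
    unfolding eq sign_pattern_def
  proof (intro conjI ballI H)
    fix v assume v: "v \<in> vertices n"
    define a where "a = x \<bullet> e v"
    define b where "b = y \<bullet> e v"
    have sgn: "a < 0 \<longleftrightarrow> b < 0" "a > 0 \<longleftrightarrow> b > 0" "a < 0 \<longleftrightarrow> v \<in> I" "a > 0 \<longleftrightarrow> v \<in> J"
      using assms(1,2) v unfolding sign_pattern_def a_def b_def by simp_all
    have c: "((1 - t) *\<^sub>R x + t *\<^sub>R y) \<bullet> e v = (1 - t) * a + t * b"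
      by (simp add: inner_add_left a_def b_def)
    consider "a < 0" "b < 0" | "a > 0" "b > 0" | "a = 0" "b = 0"
      using sgn by fastforce
    then have "((1 - t) * a + t * b < 0 \<longleftrightarrow> a < 0) \<and> ((1 - t) * a + t * b > 0 \<longleftrightarrow> a > 0)"
      by cases (use neg pos in \<open>fastforce+\<close>)
    then show "(((1 - t) *\<^sub>R x + t *\<^sub>R y) \<bullet> e v < 0) = (v \<in> I)"
        "(((1 - t) *\<^sub>R x + t *\<^sub>R y) \<bullet> e v > 0) = (v \<in> J)"
      using c sgn by simp_all
  qed
qed

text \<open>At each vertex inflow or outflow is zero, so the absolute value is their sum; each
  weight is thus counted once at its tail and once at its head.\<close>

lemma l1_comb:
  assumes w: "bipartite_weights w"
  shows "l1 (comb w) = 2 * sum w (arrows n)"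
proof -
  define A where "A v = sum w {a \<in> arrows n. snd a = v}" for v
  define B where "B v = sum w {a \<in> arrows n. fst a = v}" for v
  have nn: "0 \<le> w a" if "a \<in> arrows n" for a using w that by (simp add: bipartite_weights_def)
  have abs: "\<bar>comb w \<bullet> e v\<bar> = A v + B v" if v: "v \<in> vertices n" for v
  proof -
    have AB: "0 \<le> A v" "0 \<le> B v" unfolding A_def B_def using nn by (auto intro: sum_nonneg)
    have "A v = 0 \<or> B v = 0"
    proof (cases "v \<in> fst ` supp w")
      case True
      then have "v \<notin> snd ` supp w"
        using w by (auto simp: bipartite_weights_def)
      then have "w a = 0" if "a \<in> arrows n" "snd a = v" for a
        using that by (force simp: supp_def)
      then show ?thesis unfolding A_def by (intro disjI1 sum.neutral) auto
    next
      case False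
      then have "w a = 0" if "a \<in> arrows n" "fst a = v" for a
        using that by (force simp: supp_def)
      then show ?thesis unfolding B_def by (intro disjI2 sum.neutral) auto
    qed
    then show ?thesis using AB comb_coord[OF v, of w] by (auto simp: A_def[symmetric] B_def[symmetric])
  qed
  have "l1 (comb w) = (\<Sum>v\<in>vertices n. A v) + (\<Sum>v\<in>vertices n. B v)"
    unfolding l1_def sum.distrib[symmetric] by (intro sum.cong refl abs)
  also have "(\<Sum>v\<in>vertices n. A v) = sum w (arrows n)"
    unfolding A_def by (rule sum.group) (use finite_arrows finite_vertices arrow_ends in auto)
  also have "(\<Sum>v\<in>vertices n. B v) = sum w (arrows n)"
    unfolding B_def by (rule sum.group) (use finite_arrows finite_vertices arrow_ends in auto)
  finally show ?thesis by simp
qed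

end

section \<open>Uniqueness of conical representations\<close>

locale framed_complex = arrow_complex n \<Delta> + orthonormal_frame n e
  for n \<Delta> and e :: "nat \<Rightarrow> 'v::euclidean_space"
begin

lemma vertices_face: "\<sigma> \<in> \<Delta> \<Longrightarrow> fst ` \<sigma> \<subseteq> vertices n" "\<sigma> \<in> \<Delta> \<Longrightarrow> snd ` \<sigma> \<subseteq> vertices n"
  using face_vertices[of \<sigma>] by (simp_all add: vertices_def)

definition face_weights :: "(arrow \<Rightarrow> real) \<Rightarrow> bool" where
  "face_weights w \<longleftrightarrow> supp w \<in> \<Delta> \<and> (\<forall>a\<in>arrows n. 0 \<le> w a)"

lemma face_weights_bipartite: "face_weights w \<Longrightarrow> bipartite_weights w"
  using tails_heads_disjoint[of "supp w"] by (simp add: face_weights_def bipartite_weights_def)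

end

locale framed_matching_complex = matching_complex n \<Delta> + orthonormal_frame n e
  for n \<Delta> and e :: "nat \<Rightarrow> 'v::euclidean_space"

sublocale framed_matching_complex \<subseteq> framed_complex ..

text \<open>The signs of the coordinates forbid both representations to enter the tail of
  \<open>a\<close> or to leave its head. So their outflows at the tail agree, as do their inflows at
  the head, and the surplus of \<open>w\<close> on \<open>a\<close> must be made up by another arrow
  there.\<close>

lemma (in framed_complex) opposite_sign_partner:
  assumes w: "face_weights w" and w': "face_weights w'"
    and eq: "comb w = comb w'" and a: "a \<in> arrows n" "w' a < w a"
  shows "\<exists>b\<in>arrows n. fst b = fst a \<and> w b < w' b"
    and "\<exists>b\<in>arrows n. snd b = snd a \<and> w b < w' b"
proof -
  have as: "a \<in> supp w" using a w' by (fastforce simp: supp_def face_weights_def)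
  note ends = arrow_ends[OF a(1)]
  have tail: "comb w \<bullet> e (fst a) < 0" and head: "comb w \<bullet> e (snd a) > 0"
    by (rule comb_tail_neg[OF face_weights_bipartite[OF w] as],
      rule comb_head_pos[OF face_weights_bipartite[OF w] as])
  have none: "u b = 0" if u: "face_weights u" "comb u = comb w"
    and b: "b \<in> arrows n" "snd b = fst a \<or> fst b = snd a" for u b
    using comb_head_pos[OF face_weights_bipartite[OF u(1)], of b]
      comb_tail_neg[OF face_weights_bipartite[OF u(1)], of b] u(2) b tail head
    by (fastforce simp: supp_def)
  have z: "(\<Sum>b\<in>{b \<in> arrows n. snd b = fst a}. u b) = 0"
      "(\<Sum>b\<in>{b \<in> arrows n. fst b = snd a}. u b) = 0"
    if u: "face_weights u" "comb u = comb w" for u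
    using none[OF u] by (simp_all add: sum.neutral)
  have sums: "(\<Sum>b\<in>{b \<in> arrows n. fst b = fst a}. w b) = (\<Sum>b\<in>{b \<in> arrows n. fst b = fst a}. w' b)"
      "(\<Sum>b\<in>{b \<in> arrows n. snd b = snd a}. w b) = (\<Sum>b\<in>{b \<in> arrows n. snd b = snd a}. w' b)"
    using comb_coord[OF ends(1), of w] comb_coord[OF ends(1), of w']
      comb_coord[OF ends(2), of w] comb_coord[OF ends(2), of w']
      z[OF w refl] z[OF w' eq[symmetric]] eq by simp_all
  have ex: "\<exists>b\<in>A. w b < w' b" if "a \<in> A" "A \<subseteq> arrows n" "sum w A = sum w' A" for A
  proof (rule ccontr)
    assume "\<not> ?thesis"
    moreover have "finite A" using that(2) finite_arrows finite_subset by blast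
    ultimately have "sum w' A < sum w A"
      using a that(1) by (intro sum_strict_mono_ex1) (auto simp: not_less)
    then show False using that(3) by simp
  qed
  have "\<exists>b\<in>{b \<in> arrows n. fst b = fst a}. w b < w' b"
    by (rule ex) (use a(1) sums in auto)
  then show "\<exists>b\<in>arrows n. fst b = fst a \<and> w b < w' b" by blast
  have "\<exists>b\<in>{b \<in> arrows n. snd b = snd a}. w b < w' b"
    by (rule ex) (use a(1) sums in auto)
  then show "\<exists>b\<in>arrows n. snd b = snd a \<and> w b < w' b" by blast
qed

context framed_matching_complex begin

text \<open>
  The difference of two representations is a circulation; following arrows of alternating sign yields
  two disjoint matchings with the same ends, one in each support.
\<close>

lemma comb_le:
  assumes w: "face_weights w" and w': "face_weights w'"
    and eq: "comb w = comb w'" and a: "a \<in> arrows n"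
  shows "w a \<le> w' a"
proof (rule ccontr)
  assume "\<not> w a \<le> w' a"
  define P where "P = {a \<in> arrows n. w' a < w a}"
  define Q where "Q = {a \<in> arrows n. w a < w' a}"
  have "a \<in> P" using a \<open>\<not> w a \<le> w' a\<close> by (simp add: P_def)
  have P_head: "\<exists>k. (k, snd b) \<in> Q" if "b \<in> P" for b
  proof -
    have "b \<in> arrows n" "w' b < w b" using that by (simp_all add: P_def)
    from opposite_sign_partner(2)[OF w w' eq this]
    obtain c where "c \<in> arrows n" "snd c = snd b" "w c < w' c" by blast
    then show ?thesis by (intro exI[of _ "fst c"]) (cases c, simp add: Q_def)
  qed
  have Q_tail: "fst b \<in> fst ` P" if "b \<in> Q" for b
  proof -
    have "b \<in> arrows n" "w b < w' b" using that by (simp_all add: Q_def)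
    from opposite_sign_partner(1)[OF w' w eq[symmetric] this]
    obtain c where "c \<in> arrows n" "fst c = fst b" "w' c < w c" by blast
    then show ?thesis by (metis (mono_tags, lifting) P_def image_eqI mem_Collect_eq)
  qed
  have finP: "finite P" using finite_arrows by (simp add: P_def)
  have "\<forall>i\<in>fst ` P. \<exists>j. (i, j) \<in> P" by force
  then obtain p where p: "\<And>i. i \<in> fst ` P \<Longrightarrow> (i, p i) \<in> P" by metis
  have "\<forall>j\<in>snd ` P. \<exists>k. (k, j) \<in> Q" using P_head by blast
  then obtain f where f': "\<And>j. j \<in> snd ` P \<Longrightarrow> (f j, j) \<in> Q" by metis
  have f: "(f (p i), p i) \<in> Q" if "i \<in> fst ` P" for i
    using f' p[OF that] by force
  \<comment> \<open>An arrow of \<open>P\<close> leads from a tail to a head, an arrow of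
    \<open>Q\<close> is followed backwards to a tail, and by \<open>Q_tail\<close> an arrow of
    \<open>P\<close> starts there again.\<close>
  have "(f \<circ> p) ` fst ` P \<subseteq> fst ` P" using Q_tail[OF f] by auto
  then obtain B where B: "B \<subseteq> fst ` P" "B \<noteq> {}" "(f \<circ> p) ` B = B" "inj_on (f \<circ> p) B"
    using finite_self_map_core[of "fst ` P" "f \<circ> p"] finP \<open>a \<in> P\<close> by blast
  have inj: "inj_on p B" using B(4) by (rule inj_on_imageI2)
  define m where "m = (\<lambda>i. (i, p i)) ` B"
  define m' where "m' = (\<lambda>i. (f (p i), p i)) ` B"
  have "(i, p i) \<in> P" "(f (p i), p i) \<in> Q" if "i \<in> B" for i
    using p f subsetD[OF B(1) that] by simp_all
  then have mP: "m \<subseteq> P" and mQ: "m' \<subseteq> Q" by (auto simp: m_def m'_def)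
  have "P \<subseteq> supp w" "Q \<subseteq> supp w'"
    using w w' by (fastforce simp: P_def Q_def supp_def face_weights_def)+
  moreover have "supp w \<in> \<Delta>" "supp w' \<in> \<Delta>" using w w' by (simp_all add: face_weights_def)
  ultimately have "m \<in> \<Delta>" "m' \<in> \<Delta>" using mP mQ by (meson subface order.trans)+
  moreover have "inj_on fst m" "inj_on snd m" "inj_on fst m'" "inj_on snd m'"
    using inj B(4) by (auto simp: inj_on_def m_def m'_def)
  moreover have "fst ` m = fst ` m'" "snd ` m = snd ` m'"
    using B(3) by (simp_all add: m_def m'_def image_image)
  ultimately have "m = m'" by (intro unique_matching)
  moreover have "P \<inter> Q = {}" by (auto simp: P_def Q_def)
  ultimately show False using mP mQ B(2) by (auto simp: m_def)
qed

lemma comb_unique: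
  assumes "face_weights w" "face_weights w'"
    and "comb w = comb w'" and "a \<in> arrows n"
  shows "w a = w' a"
  using comb_le[OF assms(1-3), of a] comb_le[OF assms(2,1), of a] assms(3,4) by (simp add: order.antisym)

text \<open>The positive and the negative part of the coefficients are two systems of weights on the
  same face with the same \<open>comb\<close>, so they agree; having disjoint supports, they
  vanish.\<close>

lemma face_coeff_zero:
  assumes s: "\<sigma> \<in> \<Delta>" and z: "(\<Sum>a\<in>\<sigma>. c a *\<^sub>R V a) = 0" and a: "a \<in> \<sigma>"
  shows "c a = 0"
proof -
  define w where "w = (\<lambda>a. if a \<in> \<sigma> then max (c a) 0 else 0)"
  define w' where "w' = (\<lambda>a. if a \<in> \<sigma> then max (- c a) 0 else 0)"
  note sub = face_arrows[OF s]
  have "supp w \<in> \<Delta>" "supp w' \<in> \<Delta>"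
    by (rule subface[OF s], auto simp: supp_def w_def w'_def split: if_splits)+
  then have "face_weights w" "face_weights w'"
    by (simp_all add: face_weights_def w_def w'_def)
  moreover have "comb w - comb w' = (\<Sum>a\<in>\<sigma>. c a *\<^sub>R V a)"
    unfolding w_def w'_def comb_restrict[OF sub] sum_subtractf[symmetric]
    by (intro sum.cong refl) (simp add: max_def flip: scaleR_left_diff_distrib)
  ultimately have "w a = w' a" using z sub a by (intro comb_unique) auto
  then show ?thesis using a by (auto simp: w_def w'_def max_def split: if_splits)
qed

lemma independent_face:
  assumes s: "\<sigma> \<in> \<Delta>"
  shows "independent (V ` \<sigma>)"
proof
  have inj: "inj_on V \<sigma>" using inj_V face_arrows[OF s] by (rule inj_on_subset)
  assume "dependent (V ` \<sigma>)"
  then obtain u x where u: "x \<in> V ` \<sigma>" "u x \<noteq> 0" "(\<Sum>v\<in>V ` \<sigma>. u v *\<^sub>R v) = 0"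
    using dependent_finite[of "V ` \<sigma>"] finite_face[OF s] by auto
  have "(\<Sum>a\<in>\<sigma>. u (V a) *\<^sub>R V a) = 0"
    using u(3) by (simp add: sum.reindex[OF inj])
  then show False using face_coeff_zero[OF s, of "\<lambda>a. u (V a)"] u by blast
qed

end

section \<open>Existence of conical representations\<close>

lemma finite_line_subspace:
  fixes U :: "'a::real_vector set"
  assumes "subspace U" "v \<notin> U"
  shows "finite {t. x + t *\<^sub>R v \<in> U}"
proof -
  have "s = t" if st: "x + s *\<^sub>R v \<in> U" "x + t *\<^sub>R v \<in> U" for s t
  proof (rule ccontr)
    assume "s \<noteq> t"
    have "(x + s *\<^sub>R v) - (x + t *\<^sub>R v) = (s - t) *\<^sub>R v" by (simp add: algebra_simps)
    then have "(s - t) *\<^sub>R v \<in> U" using subspace_diff[OF assms(1) st] by simp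
    then have "(1 / (s - t)) *\<^sub>R ((s - t) *\<^sub>R v) \<in> U" by (rule subspace_scale[OF assms(1)])
    then show False using assms(2) \<open>s \<noteq> t\<close> by simp
  qed
  then have "{t. x + t *\<^sub>R v \<in> U} = {} \<or> (\<exists>s. {t. x + t *\<^sub>R v \<in> U} = {s})" by blast
  then show ?thesis by auto
qed

text \<open>A real vector space is no finite union of proper subspaces. If the vector
  \<open>v\<close> found so far lies in the new \<open>U\<close>, a line with direction
  \<open>v\<close> through a point outside \<open>U\<close> stays outside \<open>U\<close> and meets
  each earlier subspace at most once.\<close>

lemma subspace_avoid_finite:
  fixes S :: "'a::real_vector set"
  assumes "subspace S" "finite F" "\<And>U. U \<in> F \<Longrightarrow> subspace U" "\<And>U. U \<in> F \<Longrightarrow> \<not> S \<subseteq> U"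
  obtains v where "v \<in> S" "\<And>U. U \<in> F \<Longrightarrow> v \<notin> U"
proof -
  have "\<exists>v\<in>S. \<forall>U\<in>F. v \<notin> U"
    using assms(2-)
  proof (induction F)
    case empty
    then show ?case using subspace_0[OF assms(1)] by blast
  next
    case (insert U F)
    then obtain v where v: "v \<in> S" "\<forall>U\<in>F. v \<notin> U" by auto
    obtain x where x: "x \<in> S" "x \<notin> U" using insert.prems(2)[of U] by auto
    show ?case
    proof (cases "v \<in> U")
      case False
      then show ?thesis using v by auto
    next
      case True
      have "finite {t. \<exists>W\<in>F. x + t *\<^sub>R v \<in> W}"
        unfolding Collect_bex_eq
      proof (intro finite_UN_I insert.hyps)
        fix W assume W: "W \<in> F"
        show "finite {t. x + t *\<^sub>R v \<in> W}"
          by (rule finite_line_subspace) (use W v insert.prems in auto)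
      qed
      then obtain t where "\<forall>W\<in>F. x + t *\<^sub>R v \<notin> W"
        using ex_new_if_finite[OF infinite_UNIV_char_0] by blast
      moreover have "x + t *\<^sub>R v \<notin> U"
        using x(2) True insert.prems(1)[of U] by (metis add_diff_cancel_right' insertI1 subspace_diff subspace_scale)
      moreover have "x + t *\<^sub>R v \<in> S" using x v assms(1) by (simp add: subspace_add subspace_scale)
      ultimately show ?thesis by auto
    qed
  qed
  then show ?thesis using that by blast
qed

lemma convex_cone_sum:
  assumes "convex_cone C" "\<And>a. a \<in> A \<Longrightarrow> f a \<in> C"
  shows "sum f A \<in> C"
  using assms(2)
proof (induction A rule: infinite_finite_induct)
  case (insert a A)
  then show ?case using convex_cone_add[OF assms(1)] by simp
qed (simp_all add: convex_cone_contains_0[OF assms(1)])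

section \<open>The union of the cones\<close>

context framed_complex begin

definition fan :: "'v set" where
  "fan = comb ` {w. face_weights w}"

text \<open>This form shows a finite union of finitely generated cones, from which closedness
  follows.\<close>

lemma fan_conv: "fan = (\<Union>\<sigma>\<in>\<Delta>. convex_cone hull (V ` \<sigma>))"
proof (intro equalityI subsetI)
  fix x assume "x \<in> fan"
  then obtain w where w: "face_weights w" "x = comb w" by (auto simp: fan_def)
  have "comb w \<in> convex_cone hull (V ` supp w)"
    unfolding comb_supp[of w]
  proof (rule convex_cone_sum)
    show "convex_cone (convex_cone hull (V ` supp w))" by (rule convex_cone_convex_cone_hull)
    fix a assume a: "a \<in> supp w"
    then have "0 \<le> w a" using w(1) by (auto simp: face_weights_def supp_def)
    then show "w a *\<^sub>R V a \<in> convex_cone hull (V ` supp w)"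
      using a by (intro convex_cone_hull_mul hull_inc imageI)
  qed
  then show "x \<in> (\<Union>\<sigma>\<in>\<Delta>. convex_cone hull (V ` \<sigma>))" using w by (auto simp: face_weights_def)
next
  fix x assume "x \<in> (\<Union>\<sigma>\<in>\<Delta>. convex_cone hull (V ` \<sigma>))"
  then obtain \<sigma> where s: "\<sigma> \<in> \<Delta>" "x \<in> convex_cone hull (V ` \<sigma>)" by blast
  let ?W = "{w. (\<forall>a. 0 \<le> w a) \<and> supp w \<subseteq> \<sigma>}"
  note sub = face_arrows[OF s(1)]
  have "convex_cone hull (V ` \<sigma>) \<subseteq> comb ` ?W"
  proof (rule hull_minimal)
    show "V ` \<sigma> \<subseteq> comb ` ?W"
    proof (intro subsetI)
      fix y assume "y \<in> V ` \<sigma>"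
      then obtain a where a: "a \<in> \<sigma>" "y = V a" by blast
      have "comb (\<lambda>b. of_bool (b = a)) = (\<Sum>b\<in>arrows n. if b = a then V b else 0)"
        unfolding comb_def by (intro sum.cong refl) simp
      also have "\<dots> = V a" using sub a(1) finite_arrows by auto
      finally have "comb (\<lambda>b. of_bool (b = a)) = V a" .
      moreover have "supp (\<lambda>b. of_bool (b = a)) \<subseteq> \<sigma>" using a(1) by (auto simp: supp_def)
      ultimately show "y \<in> comb ` ?W" using a(2) by (intro image_eqI[of _ _ "\<lambda>b. of_bool (b = a)"]) auto
    qed
    show "convex_cone (comb ` ?W)"
      unfolding convex_cone_iff
    proof (intro conjI allI ballI impI)
      have "comb (\<lambda>_. 0) = 0" by (simp add: comb_def)
      then show "0 \<in> comb ` ?W" by (intro image_eqI[of _ _ "\<lambda>_. 0"]) (auto simp: supp_def)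
    next
      fix y z assume "y \<in> comb ` ?W" "z \<in> comb ` ?W"
      then obtain w w' where w: "w \<in> ?W" "y = comb w" "w' \<in> ?W" "z = comb w'" by blast
      have eq: "comb (\<lambda>a. w a + w' a) = y + z"
        by (simp add: comb_def w scaleR_add_left sum.distrib)
      have "supp (\<lambda>a. w a + w' a) \<subseteq> supp w \<union> supp w'" by (auto simp: supp_def)
      then have "supp (\<lambda>a. w a + w' a) \<subseteq> \<sigma>" using w by blast
      then have "(\<lambda>a. w a + w' a) \<in> ?W" using w by simp
      then show "y + z \<in> comb ` ?W" unfolding eq[symmetric] by (rule imageI)
    next
      fix y and c :: real assume "y \<in> comb ` ?W" "0 \<le> c"
      then obtain w where w: "w \<in> ?W" "y = comb w" by blast
      have "comb (\<lambda>a. c * w a) = c *\<^sub>R y"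
        by (simp add: comb_def w scaleR_sum_right)
      then show "c *\<^sub>R y \<in> comb ` ?W"
        using w \<open>0 \<le> c\<close> by (intro image_eqI[of _ _ "\<lambda>a. c * w a"]) (auto simp: supp_def)
    qed
  qed
  then obtain w where "w \<in> ?W" "x = comb w" using s(2) by blast
  then show "x \<in> fan"
    using subface[OF s(1)] by (auto simp: fan_def face_weights_def)
qed

lemma closed_fan: "closed fan"
  unfolding fan_conv using finite_complex finite_face
  by (intro closed_UN ballI closed_convex_cone_hull finite_imageI)

text \<open>Positive weights tolerate a small change of either sign, so the direction needs
  nonnegative coefficients just on the arrows that are new to the support.\<close>

lemma eventually_in_fan:
  assumes w: "face_weights w" and r: "\<rho> \<in> \<Delta>" "supp w \<subseteq> \<rho>"
    and d: "d = (\<Sum>a\<in>\<rho>. c a *\<^sub>R V a)" and c: "\<And>a. a \<in> \<rho> - supp w \<Longrightarrow> 0 \<le> c a"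
  shows "\<forall>\<^sub>F t in at_right 0. comb w + t *\<^sub>R d \<in> fan"
proof -
  have pos: "w a > 0" if "a \<in> supp w" for a
    using that w by (fastforce simp: supp_def face_weights_def order.order_iff_strict)
  have "\<forall>\<^sub>F t in at_right 0. 0 < w a + t * c a" if "a \<in> supp w" for a
  proof (rule order_tendstoD(1))
    show "((\<lambda>t. w a + t * c a) \<longlongrightarrow> w a + 0 * c a) (at_right 0)"
      by (intro tendsto_intros)
  qed (use pos[OF that] in simp)
  then have "\<forall>\<^sub>F t in at_right 0. \<forall>a\<in>supp w. 0 < w a + t * c a"
    using finite_arrows by (intro eventually_ball_finite) (auto simp: supp_def)
  then show ?thesis
    using eventually_at_right_less
  proof eventually_elim
    case (elim t)
    define u where "u a = w a + (if a \<in> \<rho> then t * c a else 0)" for a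
    have z: "w a = 0" if "a \<in> arrows n" "a \<notin> supp w" for a using that by (simp add: supp_def)
    have "0 \<le> u a" if a: "a \<in> arrows n" for a
    proof (cases "a \<in> supp w")
      case True
      then show ?thesis using elim(1) r(2) by (auto simp: u_def less_imp_le)
    next
      case False
      then show ?thesis using z[OF a] c[of a] elim(2) by (simp add: u_def)
    qed
    moreover have "supp u \<subseteq> \<rho>" using z r(2) by (auto simp: supp_def u_def)
    ultimately have "face_weights u" using subface[OF r(1)] by (simp add: face_weights_def)
    moreover have "comb u = comb w + t *\<^sub>R d"
    proof -
      have "comb u = comb w + comb (\<lambda>a. if a \<in> \<rho> then t * c a else 0)"
        by (simp add: comb_def u_def scaleR_add_left sum.distrib)
      then show ?thesis
        by (simp add: comb_restrict[OF face_arrows[OF r(1)]] d scaleR_sum_right)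
    qed
    ultimately show ?case by (auto simp: fan_def intro!: image_eqI[of _ _ u])
  qed
qed

lemma span_face_coeffs:
  assumes "\<sigma> \<in> \<Delta>" "x \<in> span (V ` \<sigma>)"
  obtains c where "x = (\<Sum>a\<in>\<sigma>. c a *\<^sub>R V a)"
proof -
  have inj: "inj_on V \<sigma>" using inj_V face_arrows[OF assms(1)] by (rule inj_on_subset)
  obtain u where "x = (\<Sum>v\<in>V ` \<sigma>. u v *\<^sub>R v)"
    using assms(2) span_finite[of "V ` \<sigma>"] finite_face[OF assms(1)] by auto
  then show ?thesis using that[of "u \<circ> V"] by (simp add: sum.reindex[OF inj])
qed

end

section \<open>Crossing walls and filling the cells\<close>

context framed_matching_complex begin

text \<open>
  Call two vertices equivalent if the difference of their basis vectors is in the span of the face. If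
  the face spans a hyperplane of \<open>W\<close>, there are two classes, and an arrow connecting them in the
  right direction points to the same side as \<open>d\<close>.
\<close>

lemma cross_wall:
  assumes w: "face_weights w" and supp: "supp w \<subseteq> I \<times> J" "fst ` supp w = I" "snd ` supp w = J"
    and i0: "i0 \<in> I" and IJ: "I \<inter> J = {}" and W: "subspace W" "V ` (I \<times> J) \<subseteq> W"
    and Wv: "\<And>v. v \<in> I \<union> J \<Longrightarrow> e v - e i0 \<in> W"
    and WV: "\<And>Y. subspace Y \<Longrightarrow> (\<And>v. v \<in> I \<union> J \<Longrightarrow> e v - e i0 \<in> Y) \<Longrightarrow> W \<subseteq> Y"
    and dim: "dim W \<le> dim (V ` supp w) + 1" and d: "d \<in> W"
  shows "\<forall>\<^sub>F t in at_right 0. comb w + t *\<^sub>R d \<in> fan"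
proof -
  define \<sigma> where "\<sigma> = supp w"
  have sD: "\<sigma> \<in> \<Delta>" using w by (simp add: face_weights_def \<sigma>_def)
  define Y where "Y = span (V ` \<sigma>)"
  have subY: "subspace Y" by (simp add: Y_def)
  have VY: "V a \<in> Y" if "a \<in> \<sigma>" for a using that by (simp add: Y_def span_base)
  have inY: ?thesis if dY: "d \<in> Y"
  proof -
    obtain c where "d = (\<Sum>a\<in>\<sigma>. c a *\<^sub>R V a)"
      by (rule span_face_coeffs[OF sD dY[unfolded Y_def]])
    then show ?thesis by (intro eventually_in_fan[OF w sD]) (auto simp: \<sigma>_def)
  qed
  show ?thesis
  \<comment> \<open>If all vertices are equivalent, the face already spans \<open>W\<close>, and its
    positive weights can absorb any direction.\<close>
  proof (cases "\<forall>v\<in>I \<union> J. e v - e i0 \<in> Y")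
    case True
    then have "W \<subseteq> Y" using WV[OF subY] by blast
    then show ?thesis using inY d by blast
  next
    case False
    then obtain z where z: "z \<in> I \<union> J" "e z - e i0 \<notin> Y" by blast
    define S where "S = {v \<in> I \<union> J. e v - e i0 \<in> Y}"
    \<comment> \<open>Arrows of the face have both ends or no end in the class \<open>S\<close> of
      \<open>i0\<close>, so this functional vanishes on \<open>Y\<close>. It is 1 on an arrow
      entering \<open>S\<close> and -1 on an arrow leaving it.\<close>
    define f where "f x = (\<Sum>v\<in>S. x \<bullet> e v)" for x :: 'v
    have IJn: "I \<union> J \<subseteq> vertices n" using vertices_face[OF sD] supp by (simp add: \<sigma>_def)
    have finS: "finite S" using finite_subset[OF _ finite_vertices] IJn by (auto simp: S_def)
    have Sn: "S \<subseteq> vertices n" using IJn by (auto simp: S_def)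
    have fe: "f (e u) = of_bool (u \<in> S)" if "u \<in> vertices n" for u
    proof -
      have "f (e u) = (\<Sum>v\<in>S. if u = v then 1 else 0)"
        unfolding f_def using Sn that by (intro sum.cong refl orth) auto
      then show ?thesis using finS by simp
    qed
    have flin: "f (x + y) = f x + f y" "f (x - y) = f x - f y" "f (c *\<^sub>R x) = c * f x" for x y c
      by (simp_all add: f_def inner_add_left inner_diff_left sum.distrib sum_subtractf sum_distrib_left)
    have sameS: "fst a \<in> S \<longleftrightarrow> snd a \<in> S" if a: "a \<in> \<sigma>" for a
    proof -
      have e: "fst a \<in> I \<union> J" "snd a \<in> I \<union> J" using a supp by (auto simp: \<sigma>_def)
      have Va: "V a \<in> Y" using VY[OF a] .
      have "e (snd a) - e i0 \<in> Y" if "e (fst a) - e i0 \<in> Y"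
        using subspace_add[OF subY that Va] by (simp add: arrow_vertex_def split_def)
      moreover have "e (fst a) - e i0 \<in> Y" if "e (snd a) - e i0 \<in> Y"
        using subspace_diff[OF subY that Va] by (simp add: arrow_vertex_def split_def)
      ultimately show ?thesis using e unfolding S_def by blast
    qed
    have fV: "f (V (i, j)) = of_bool (j \<in> S) - of_bool (i \<in> S)"
      if "i \<in> vertices n" "j \<in> vertices n" for i j
      using that by (simp add: V_pair flin fe)
    have "subspace {x. f x = 0}"
      using flin(1,3) by (auto simp: subspace_def f_def)
    moreover have "V ` \<sigma> \<subseteq> {x. f x = 0}"
    proof
      fix x assume "x \<in> V ` \<sigma>"
      then obtain a where a: "a \<in> \<sigma>" "x = V a" by blast
      then have "fst a \<in> vertices n" "snd a \<in> vertices n" using vertices_face[OF sD] by auto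
      then show "x \<in> {x. f x = 0}" using fV[of "fst a" "snd a"] sameS[OF a(1)] a(2) by simp
    qed
    ultimately have fY: "f y = 0" if "y \<in> Y" for y
      using span_minimal[of "V ` \<sigma>" "{x. f x = 0}"] that unfolding Y_def by blast
    define g where "g = e z - e i0"
    have i0S: "i0 \<in> S" using i0 subspace_0[OF subY] by (simp add: S_def)
    have zS: "z \<notin> S" using z by (simp add: S_def)
    have fg: "f g = -1" using i0S zS subsetD[OF IJn z(1)] subsetD[OF Sn i0S] by (simp add: g_def flin fe)
    have YW: "Y \<subseteq> W" unfolding Y_def by (rule span_minimal) (use W supp \<sigma>_def in auto)
    \<comment> \<open>\<open>Y\<close> has codimension at most one in \<open>W\<close> and misses
      \<open>g\<close>, so together they span \<open>W\<close>. Since \<open>f g\<close> is nonzero,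
      \<open>Y\<close> is exactly the kernel of \<open>f\<close> in \<open>W\<close>.\<close>
    have "span (insert g (V ` \<sigma>)) = W"
    proof (rule subspace_dim_equal)
      show "span (insert g (V ` \<sigma>)) \<subseteq> W"
        by (rule span_minimal) (use W supp Wv[OF z(1)] \<sigma>_def g_def in auto)
      show "dim W \<le> dim (span (insert g (V ` \<sigma>)))"
        using dim z(2) by (simp add: dim_insert g_def Y_def \<sigma>_def)
    qed (use W in auto)
    then have decomp: "\<exists>c. x - c *\<^sub>R g \<in> Y" if "x \<in> W" for x
      using span_breakdown_eq[of x g "V ` \<sigma>"] that by (simp add: Y_def)
    have kerY: "x \<in> Y" if x: "x \<in> W" "f x = 0" for x
    proof -
      obtain c where c: "x - c *\<^sub>R g \<in> Y" using decomp[OF x(1)] by blast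
      then have "f x - c * f g = 0" using fY[OF c] by (simp add: flin)
      then show ?thesis using c x(2) fg by simp
    qed
    show ?thesis
    proof (cases "f d = 0")
      case True
      then show ?thesis using inY kerY d by blast
    next
      case False
      define c1 where "c1 = {a \<in> \<sigma>. fst a \<in> S}"
      define c2 where "c2 = {a \<in> \<sigma>. fst a \<notin> S}"
      have c12: "c1 \<in> \<Delta>" "c2 \<in> \<Delta>" "c1 \<union> c2 = \<sigma>" "c2 \<union> c1 = \<sigma>"
        using subface[OF sD] by (auto simp: c1_def c2_def)
      have sub1: "fst ` c1 \<subseteq> S" "snd ` c1 \<subseteq> S" and sub2: "fst ` c2 \<subseteq> - S" "snd ` c2 \<subseteq> - S"
        using sameS by (auto simp: c1_def c2_def)
      have disj: "(fst ` c1 \<union> snd ` c1) \<inter> (fst ` c2 \<union> snd ` c2) = {}"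
        "(fst ` c2 \<union> snd ` c2) \<inter> (fst ` c1 \<union> snd ` c1) = {}"
        using sub1 sub2 by blast+
      have ne1: "c1 \<noteq> {}" using i0S supp(2) i0 by (auto simp: c1_def \<sigma>_def)
      have "\<exists>a\<in>\<sigma>. fst a = z \<or> snd a = z" using z(1) supp by (auto simp: \<sigma>_def)
      then have "\<exists>a\<in>\<sigma>. fst a \<notin> S" using zS sameS by metis
      then have ne2: "c2 \<noteq> {}" by (auto simp: c2_def)
      \<comment> \<open>A negative \<open>f d\<close> calls for an arrow out of \<open>S\<close>, a
        positive one for an arrow into \<open>S\<close>; \<open>connecting_arrow\<close> offers
        both, according to the order of its two faces.\<close>
      obtain i j where ij: "i \<in> I" "j \<in> J" "insert (i, j) \<sigma> \<in> \<Delta>" "f (V (i, j)) = sgn (f d)"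
      proof (cases "f d < 0")
        case True
        obtain i j where ij: "i \<in> fst ` c1" "j \<in> snd ` c2" "insert (i, j) (c1 \<union> c2) \<in> \<Delta>"
          by (rule connecting_arrow[of c1 c2]) (use c12 ne1 ne2 sD disj(1) in simp_all)
        have m: "i \<in> I" "j \<in> J" using ij(1,2) supp by (auto simp: c1_def c2_def \<sigma>_def)
        have "i \<in> S" "j \<notin> S" using ij(1,2) sub1 sub2 by auto
        then have "f (V (i, j)) = sgn (f d)" using True m IJn by (subst fV) auto
        then show ?thesis using that m ij(3) c12 by simp
      next
        case neg: False
        obtain i j where ij: "i \<in> fst ` c2" "j \<in> snd ` c1" "insert (i, j) (c2 \<union> c1) \<in> \<Delta>"
          by (rule connecting_arrow[of c2 c1]) (use c12 ne1 ne2 sD disj(2) in simp_all)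
        have m: "i \<in> I" "j \<in> J" using ij(1,2) supp by (auto simp: c1_def c2_def \<sigma>_def)
        have "i \<notin> S" "j \<in> S" using ij(1,2) sub1 sub2 by auto
        then have "f (V (i, j)) = sgn (f d)" using False neg m IJn by (subst fV) auto
        then show ?thesis using that m ij(3) c12 by simp
      qed
      \<comment> \<open>The new arrow receives a nonnegative coefficient, chosen so that the
        remainder is in the kernel of \<open>f\<close>, hence in \<open>Y\<close>, where
        coefficients of any sign are allowed.\<close>
      define d' where "d' = d - \<bar>f d\<bar> *\<^sub>R V (i, j)"
      have "d' \<in> W" unfolding d'_def
        using d W ij by (intro subspace_diff subspace_scale) auto
      moreover have "f d' = 0" by (simp add: d'_def flin ij(4) abs_sgn mult.commute sgn_mult_abs)
      ultimately have d'Y: "d' \<in> Y" by (rule kerY)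
      obtain c where c: "d' = (\<Sum>a\<in>\<sigma>. c a *\<^sub>R V a)"
        by (rule span_face_coeffs[OF sD d'Y[unfolded Y_def]])
      have new: "(i, j) \<notin> \<sigma>"
      proof
        assume "(i, j) \<in> \<sigma>"
        then have "f (V (i, j)) = 0" using fY VY by blast
        then show False using ij(4) False by (simp add: sgn_0_0)
      qed
      define c' where "c' a = (if a = (i, j) then \<bar>f d\<bar> else c a)" for a
      have "(\<Sum>a\<in>insert (i, j) \<sigma>. c' a *\<^sub>R V a) = \<bar>f d\<bar> *\<^sub>R V (i, j) + (\<Sum>a\<in>\<sigma>. c' a *\<^sub>R V a)"
        using new finite_face[OF sD] by (simp add: c'_def)
      also have "(\<Sum>a\<in>\<sigma>. c' a *\<^sub>R V a) = d'"
        unfolding c using new by (intro sum.cong refl) (auto simp: c'_def)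
      finally have "d = (\<Sum>a\<in>insert (i, j) \<sigma>. c' a *\<^sub>R V a)" by (simp add: d'_def)
      then show ?thesis
        by (rule eventually_in_fan[OF w ij(3), rotated]) (auto simp: \<sigma>_def c'_def)
    qed
  qed
qed

text \<open>Segments reach all points of the cell outside finitely many proper subspaces of
  \<open>W\<close>. Such points lie arbitrarily close to \<open>x\<close>, and \<open>fan\<close> is
  closed.\<close>

lemma sign_pattern_in_fan:
  assumes x: "sign_pattern I J x" and IJ: "I \<subseteq> vertices n" "J \<subseteq> vertices n" "I \<inter> J = {}"
    and i0: "i0 \<in> I" and J: "J \<noteq> {}"
  shows "x \<in> fan"
proof -
  obtain \<beta> where \<beta>: "\<beta> ` (I - {i0}) \<subseteq> J"
    "{i0} \<times> J \<union> (\<lambda>k. (k, \<beta> k)) ` (I - {i0}) \<in> \<Delta>"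
    by (rule star_with_leaves[OF IJ[unfolded vertices_def] J i0])
  define \<sigma>0 where "\<sigma>0 = {i0} \<times> J \<union> (\<lambda>k. (k, \<beta> k)) ` (I - {i0})"
  have s0: "\<sigma>0 \<in> \<Delta>" using \<beta>(2) by (simp add: \<sigma>0_def)
  have s0IJ: "\<sigma>0 \<subseteq> I \<times> J" "fst ` \<sigma>0 = I" "snd ` \<sigma>0 = J"
    using \<beta>(1) i0 J by (auto simp: \<sigma>0_def image_Un image_image)
  define W where "W = span (V ` \<sigma>0)"
  have subW: "subspace W" by (simp add: W_def)
  have VW: "V a \<in> W" if "a \<in> \<sigma>0" for a using that by (simp add: W_def span_base)
  have star: "e j - e i0 \<in> W" if "j \<in> J" for j
    using VW[of "(i0, j)"] that by (simp add: \<sigma>0_def V_pair)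
  have Wv: "e v - e i0 \<in> W" if v: "v \<in> I \<union> J" for v
  proof (cases "v \<in> J")
    case False
    show ?thesis
    proof (cases "v = i0")
      case True
      then show ?thesis using subspace_0[OF subW] by simp
    next
      case ne: False
      then have vI: "v \<in> I - {i0}" using v False by blast
      then have "V (v, \<beta> v) \<in> W" by (intro VW) (auto simp: \<sigma>0_def)
      moreover have "e (\<beta> v) - e i0 \<in> W" using vI \<beta>(1) by (intro star) auto
      ultimately show ?thesis using subspace_diff[OF subW, of "e (\<beta> v) - e i0" "V (v, \<beta> v)"]
        by (simp add: V_pair)
    qed
  qed (rule star)
  have Vmem: "V (i, j) \<in> Y" if "subspace Y" "e j - e i0 \<in> Y" "e i - e i0 \<in> Y" for i j Y
    using subspace_diff[OF that] by (simp add: V_pair)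
  have VIJ: "V ` (I \<times> J) \<subseteq> W"
    using Wv by (auto intro!: Vmem[OF subW])
  have WV: "W \<subseteq> Y" if Y: "subspace Y" "\<And>v. v \<in> I \<union> J \<Longrightarrow> e v - e i0 \<in> Y" for Y
    unfolding W_def
  proof (rule span_minimal[OF _ Y(1)])
    show "V ` \<sigma>0 \<subseteq> Y"
      using s0IJ(1) Y(2) by (auto intro!: Vmem[OF Y(1)])
  qed
  have inW: "y \<in> W" if y: "sign_pattern I J y" for y
  proof -
    have yH: "y \<in> H" using y by (simp add: sign_pattern_def)
    \<comment> \<open>The subtracted term is zero, as the coordinates of \<open>y\<close> sum to
      zero; it turns the expansion into one in the differences \<open>e v - e i0\<close>.\<close>
    have "y = (\<Sum>v\<in>vertices n. (y \<bullet> e v) *\<^sub>R e v) - (\<Sum>v\<in>vertices n. y \<bullet> e v) *\<^sub>R e i0"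
      using H_expansion[OF yH] H_coord_sum[OF yH] by simp
    also have "\<dots> = (\<Sum>v\<in>vertices n. (y \<bullet> e v) *\<^sub>R (e v - e i0))"
      by (simp add: scaleR_sum_left scaleR_diff_right sum_subtractf)
    also have "\<dots> \<in> W"
    proof (rule subspace_sum[OF subW])
      fix v assume v: "v \<in> vertices n"
      show "(y \<bullet> e v) *\<^sub>R (e v - e i0) \<in> W"
      proof (cases "v \<in> I \<union> J")
        case True
        then show ?thesis by (intro subspace_scale[OF subW] Wv)
      next
        case False
        then have "\<not> y \<bullet> e v < 0" "\<not> y \<bullet> e v > 0"
          using y v unfolding sign_pattern_def by blast+
        then have "y \<bullet> e v = 0" by simp
        then show ?thesis using subspace_0[OF subW] by simp
      qed
    qed
    finally show ?thesis .
  qed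
  have WH: "W \<subseteq> H" unfolding W_def H_def by (intro span_mono image_mono face_arrows s0)
  define w0 where "w0 a = (of_bool (a \<in> \<sigma>0) :: real)" for a
  have supp0: "supp w0 = \<sigma>0" using face_arrows[OF s0] by (auto simp: supp_def w0_def)
  have w0: "face_weights w0" using s0 supp0 by (simp add: face_weights_def w0_def)
  define x0 where "x0 = comb w0"
  have p0: "sign_pattern I J x0"
    using comb_sign_pattern[OF face_weights_bipartite[OF w0]] s0IJ by (simp add: x0_def supp0)
  \<comment> \<open>These are the faces to which \<open>cross_wall\<close> does not apply. Adding
    \<open>x0\<close> to one of them still spans a proper subspace of \<open>W\<close>.\<close>
  define thin where "thin = {\<tau> \<in> \<Delta>. dim (V ` \<tau>) + 2 \<le> dim W}"
  have generic: "y \<in> fan" if y: "sign_pattern I J y"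
    and gen: "\<And>\<tau>. \<tau> \<in> thin \<Longrightarrow> y \<notin> span (insert x0 (V ` \<tau>))" for y
  proof -
    define p where "p t = x0 + t *\<^sub>R (y - x0)" for t
    have psp: "sign_pattern I J (p t)" if "0 \<le> t" "t \<le> 1" for t
      unfolding p_def using sign_pattern_convex[OF p0 y] that by blast
    define T where "T = {0..1} \<inter> p -` fan"
    have "continuous_on UNIV p" unfolding p_def by (intro continuous_intros)
    then have "closed (p -` fan)" using closed_fan by (simp add: closed_vimage)
    then have "compact T" unfolding T_def by (intro compact_Int_closed) auto
    moreover have "0 \<in> T" using w0 by (auto simp: T_def p_def x0_def fan_def)
    ultimately obtain s where s: "s \<in> T" "\<And>t. t \<in> T \<Longrightarrow> t \<le> s"
      using compact_attains_sup[of T] by blast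
    have "s = 1"
    proof (rule ccontr)
      assume "s \<noteq> 1"
      then have s01: "0 \<le> s" "s < 1" using s(1) by (auto simp: T_def)
      obtain w where w: "face_weights w" "comb w = p s"
        using s(1) by (auto simp: T_def fan_def)
      have pat: "sign_pattern I J (comb w)" using psp s01 w(2) by simp
      note sw = supp_sign_pattern[OF face_weights_bipartite[OF w(1)] pat IJ(1,2)]
      have wD: "supp w \<in> \<Delta>" using w(1) by (simp add: face_weights_def)
      have "supp w \<notin> thin"
      proof
        assume thin: "supp w \<in> thin"
        show False
        \<comment> \<open>At \<open>s = 0\<close> genericity says nothing, and uniqueness shows that
          the carrier is the tree, which is not thin. For other \<open>s\<close>, the point
          \<open>y\<close> is on the line through \<open>x0\<close> and \<open>p s\<close>, so a
          thin carrier would place it in an excluded subspace.\<close>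
        proof (cases "s = 0")
          case True
          then have eq: "comb w = comb w0" using w(2) by (simp add: p_def x0_def)
          have "supp w = supp w0"
            using comb_unique[OF w(1) w0 eq] by (auto simp: supp_def)
          then show False using thin by (simp add: thin_def supp0 W_def)
        next
          case False
          have "comb w \<in> span (V ` supp w)"
            unfolding comb_supp[of w] by (intro span_sum span_scale span_base) auto
          then have "p s \<in> span (insert x0 (V ` supp w))"
            using span_mono[of "V ` supp w" "insert x0 (V ` supp w)"] w(2) by auto
          then have "x0 + (1 / s) *\<^sub>R (p s - x0) \<in> span (insert x0 (V ` supp w))"
            by (intro span_add span_scale span_diff) (simp_all add: span_base)
          moreover have "x0 + (1 / s) *\<^sub>R (p s - x0) = y" using False by (simp add: p_def)
          ultimately show False using gen[OF thin] by simp
        qed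
      qed
      then have dim: "dim W \<le> dim (V ` supp w) + 1" using wD by (simp add: thin_def)
      have dW: "y - x0 \<in> W" by (intro subspace_diff[OF subW] inW y p0)
      have "\<forall>\<^sub>F t in at_right 0. comb w + t *\<^sub>R (y - x0) \<in> fan"
        by (rule cross_wall[OF w(1) sw i0 IJ(3) subW VIJ Wv WV dim dW])
      moreover have "\<forall>\<^sub>F t in at_right 0. t < 1 - s"
        using s01 by (intro order_tendstoD(2)[OF tendsto_ident_at]) auto
      moreover have "\<forall>\<^sub>F t :: real in at_right 0. 0 < t" by (rule eventually_at_right_less)
      ultimately have "\<forall>\<^sub>F t in at_right 0. 0 < t \<and> t < 1 - s \<and> comb w + t *\<^sub>R (y - x0) \<in> fan"
        by eventually_elim simp
      then obtain t where t: "0 < t" "t < 1 - s" "comb w + t *\<^sub>R (y - x0) \<in> fan"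
        using eventually_happens'[OF trivial_limit_at_right_real] by blast
      have "p (s + t) = comb w + t *\<^sub>R (y - x0)" by (simp add: w(2) p_def algebra_simps)
      then have "s + t \<in> T" using t s01 by (simp add: T_def)
      then show False using s(2) t(1) by fastforce
    qed
    then show ?thesis using s(1) by (simp add: T_def p_def)
  qed
  define F where "F = (\<lambda>\<tau>. span (insert x0 (V ` \<tau>))) ` thin"
  have finF: "finite F" using finite_complex by (simp add: F_def thin_def)
  have notcov: "\<not> W \<subseteq> U" if "U \<in> F" for U
  proof
    assume sub: "W \<subseteq> U"
    obtain \<tau> where t: "U = span (insert x0 (V ` \<tau>))" "dim (V ` \<tau>) + 2 \<le> dim W"
      using \<open>U \<in> F\<close> by (auto simp: F_def thin_def)
    have "dim W \<le> dim (insert x0 (V ` \<tau>))" using dim_subset[OF sub] t(1) by simp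
    then show False using t(2) by (simp add: dim_insert split: if_splits)
  qed
  \<comment> \<open>The line through \<open>x\<close> with direction \<open>v\<close> meets each
    excluded subspace at most once, so small positive parameters give generic points. They stay in
    the cell: strict signs persist, and vectors of \<open>W\<close> vanish outside
    \<open>I \<union> J\<close>.\<close>
  obtain v where v: "v \<in> W" "\<And>U. U \<in> F \<Longrightarrow> v \<notin> U"
    by (rule subspace_avoid_finite[OF subW finF]) (use notcov in \<open>auto simp: F_def\<close>)
  have "finite (\<Union>U\<in>F. {t. x + t *\<^sub>R v \<in> U})"
    using v(2) by (intro finite_UN_I finF finite_line_subspace) (auto simp: F_def)
  then have "\<forall>\<^sub>F t in at_right 0. \<forall>s\<in>(\<Union>U\<in>F. {t. x + t *\<^sub>R v \<in> U}). t \<noteq> s"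
    by (intro eventually_ball_finite ballI eventually_neq_at_within)
  moreover have lim: "((\<lambda>t. x + t *\<^sub>R v) \<longlongrightarrow> x) (at_right 0)"
    by (rule tendsto_eq_intros refl | simp)+
  have "\<forall>\<^sub>F t in at_right 0. \<forall>u\<in>I \<union> J. (u \<in> I \<longrightarrow> (x + t *\<^sub>R v) \<bullet> e u < 0) \<and> (u \<in> J \<longrightarrow> (x + t *\<^sub>R v) \<bullet> e u > 0)"
  proof (intro eventually_ball_finite ballI eventually_conj)
    show "finite (I \<union> J)" using IJ finite_vertices finite_subset by blast
    fix u assume u: "u \<in> I \<union> J"
    have l: "((\<lambda>t. (x + t *\<^sub>R v) \<bullet> e u) \<longlongrightarrow> x \<bullet> e u) (at_right 0)"
      by (intro tendsto_inner lim tendsto_const)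
    show "\<forall>\<^sub>F t in at_right 0. u \<in> I \<longrightarrow> (x + t *\<^sub>R v) \<bullet> e u < 0"
      using order_tendstoD(2)[OF l, of 0] x IJ u
      by (cases "u \<in> I") (auto simp: sign_pattern_def)
    show "\<forall>\<^sub>F t in at_right 0. u \<in> J \<longrightarrow> (x + t *\<^sub>R v) \<bullet> e u > 0"
      using order_tendstoD(1)[OF l, of 0] x IJ u
      by (cases "u \<in> J") (auto simp: sign_pattern_def)
  qed
  ultimately have "\<forall>\<^sub>F t in at_right 0. x + t *\<^sub>R v \<in> fan"
  proof eventually_elim
    case (elim t)
    have xvW: "x + t *\<^sub>R v \<in> W" using v(1) inW[OF x] by (intro subspace_add subspace_scale subW)
    have v0: "v \<bullet> e u = 0" if "u \<notin> I \<union> J" "u \<in> vertices n" for u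
    proof -
      have "W \<subseteq> {y. y \<bullet> e u = 0}"
        unfolding W_def
      proof (rule span_minimal)
        show "V ` \<sigma>0 \<subseteq> {y. y \<bullet> e u = 0}"
          using that s0IJ(1) face_arrows[OF s0] V_coord[OF _ that(2)] by fastforce
      qed (auto simp: subspace_def inner_add_left)
      then show ?thesis using v(1) by blast
    qed
    show ?case
    proof (rule generic)
      show "sign_pattern I J (x + t *\<^sub>R v)"
        unfolding sign_pattern_def
      proof (intro conjI ballI)
        fix u assume u: "u \<in> vertices n"
        have out: "(x + t *\<^sub>R v) \<bullet> e u = 0" if "u \<notin> I \<union> J"
        proof -
          have "\<not> x \<bullet> e u < 0" "\<not> x \<bullet> e u > 0" using x u that unfolding sign_pattern_def by blast+
          then show ?thesis using v0[OF that u] by (simp add: inner_add_left)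
        qed
        consider "u \<in> I" "u \<notin> J" | "u \<in> J" "u \<notin> I" | "u \<notin> I" "u \<notin> J" using IJ(3) by blast
        then have "((x + t *\<^sub>R v) \<bullet> e u < 0 \<longleftrightarrow> u \<in> I) \<and> ((x + t *\<^sub>R v) \<bullet> e u > 0 \<longleftrightarrow> u \<in> J)"
        proof cases
          case 1
          then have "(x + t *\<^sub>R v) \<bullet> e u < 0" using elim(2) by blast
          then show ?thesis using 1 by simp
        next
          case 2
          then have "(x + t *\<^sub>R v) \<bullet> e u > 0" using elim(2) by blast
          then show ?thesis using 2 by simp
        next
          case 3
          then show ?thesis using out by simp
        qed
        then show "((x + t *\<^sub>R v) \<bullet> e u < 0) = (u \<in> I)" "((x + t *\<^sub>R v) \<bullet> e u > 0) = (u \<in> J)"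
          by blast+
      qed (use xvW WH in blast)
      fix \<tau> assume "\<tau> \<in> thin"
      then have "span (insert x0 (V ` \<tau>)) \<in> F" by (simp add: F_def)
      then show "x + t *\<^sub>R v \<notin> span (insert x0 (V ` \<tau>))" using elim(1) by blast
    qed
  qed
  then show ?thesis
    by (rule Lim_in_closed_set[OF closed_fan _ trivial_limit_at_right_real lim])
qed

text \<open>A nonzero vector with coordinate sum zero has coordinates of both signs and so lies in a
  cell with \<open>I\<close> and \<open>J\<close> nonempty; the origin belongs to the empty
  face.\<close>

lemma fan_complete:
  assumes x: "x \<in> H"
  obtains w where "face_weights w" "comb w = x"
proof -
  have "x \<in> fan"
  proof (cases "x = 0")
    case True
    have "face_weights (\<lambda>_. 0)" by (simp add: face_weights_def supp_def empty_face)
    moreover have "comb (\<lambda>_. 0) = 0" by (simp add: comb_def)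
    ultimately show ?thesis using True by (auto simp: fan_def intro!: image_eqI[of _ _ "\<lambda>_. 0"])
  next
    case False
    define I where "I = {v \<in> vertices n. x \<bullet> e v < 0}"
    define J where "J = {v \<in> vertices n. x \<bullet> e v > 0}"
    have zero: "x = 0" if "\<forall>v\<in>vertices n. x \<bullet> e v = 0"
      using H_expansion[OF x] that by simp
    have "I \<noteq> {}"
    proof
      assume "I = {}"
      then have "\<forall>v\<in>vertices n. 0 \<le> x \<bullet> e v" by (auto simp: I_def not_less)
      then have "\<forall>v\<in>vertices n. x \<bullet> e v = 0"
        using H_coord_sum[OF x] sum_nonneg_eq_0_iff[OF finite_vertices, of n "\<lambda>v. x \<bullet> e v"] by simp
      then show False using zero False by blast
    qed
    moreover have "J \<noteq> {}"
    proof
      assume "J = {}"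
      then have "\<forall>v\<in>vertices n. x \<bullet> e v \<le> 0" by (auto simp: J_def not_less)
      then have "\<forall>v\<in>vertices n. x \<bullet> e v = 0"
        using H_coord_sum[OF x] sum_nonneg_eq_0_iff[OF finite_vertices, of n "\<lambda>v. - (x \<bullet> e v)"]
        by (simp add: sum_negf)
      then show False using zero False by blast
    qed
    moreover have "sign_pattern I J x" using x by (auto simp: sign_pattern_def I_def J_def)
    moreover have "I \<subseteq> vertices n" "J \<subseteq> vertices n" "I \<inter> J = {}" by (auto simp: I_def J_def)
    ultimately show ?thesis using sign_pattern_in_fan[of I J x] by blast
  qed
  then show ?thesis using that by (auto simp: fan_def)
qed

end

section \<open>The boundary of the root polytope\<close>

context orthonormal_frame begin

text \<open>The origin is the midpoint of two opposite arrow vectors. The assumption excludes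
  \<open>n = 0\<close>, where the polytope is empty.\<close>

lemma root_polytope_nonempty:
  assumes "x \<in> root_polytope n e"
  shows "0 \<in> root_polytope n e"
proof -
  have "arrows n \<noteq> {}" using assms by (auto simp: root_polytope_def)
  then obtain i j where ij: "(i, j) \<in> arrows n" by auto
  then have ji: "(j, i) \<in> arrows n" by (simp add: arrows_iff)
  have "(1 / 2) *\<^sub>R V (i, j) + (1 / 2) *\<^sub>R V (j, i) \<in> root_polytope n e"
    unfolding root_polytope_def
    by (intro convexD convex_convex_hull hull_inc imageI ij ji) auto
  then show ?thesis by (simp add: V_pair algebra_simps)
qed

lemma compact_root_polytope: "compact (root_polytope n e)"
  unfolding root_polytope_def by (intro finite_imp_compact_convex_hull finite_imageI finite_arrows)

text \<open>A point of the relative interior could be pushed a little further away from the origin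
  inside the polytope, which would raise \<open>l1\<close> above 2.\<close>

lemma in_rel_frontier:
  assumes x: "x \<in> root_polytope n e" and l1: "l1 x = 2"
  shows "x \<in> rel_frontier (root_polytope n e)"
proof -
  have "x \<notin> rel_interior (root_polytope n e)"
  proof
    assume "x \<in> rel_interior (root_polytope n e)"
    moreover have "convex (root_polytope n e)" by (simp add: root_polytope_def)
    ultimately have "\<forall>y\<in>root_polytope n e. \<exists>c>1. (1 - c) *\<^sub>R y + c *\<^sub>R x \<in> root_polytope n e"
      using convex_rel_interior_iff[of "root_polytope n e" x] x by blast
    then obtain c where c: "c > 1" "(1 - c) *\<^sub>R 0 + c *\<^sub>R x \<in> root_polytope n e"
      using root_polytope_nonempty[OF x] by blast
    then have "\<bar>c\<bar> * l1 x \<le> 2" using l1_le_2[OF c(2)] by (simp add: l1_scale)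
    then show False using c(1) l1 by simp
  qed
  then show ?thesis
    using x closure_subset[of "root_polytope n e"] by (auto simp: rel_frontier_def)
qed

end

context framed_complex begin

lemma convex_hull_face:
  assumes s: "\<sigma> \<in> \<Delta>"
  shows "convex hull (V ` \<sigma>) = comb ` {w. face_weights w \<and> supp w \<subseteq> \<sigma> \<and> sum w (arrows n) = 1}"
proof (intro equalityI subsetI)
  note sub = face_arrows[OF s] and fin = finite_face[OF s]
  have inj: "inj_on V \<sigma>" using inj_V sub by (rule inj_on_subset)
  {
    fix x assume "x \<in> convex hull (V ` \<sigma>)"
    then obtain u where u: "\<And>v. v \<in> V ` \<sigma> \<Longrightarrow> 0 \<le> u v" "sum u (V ` \<sigma>) = 1" "(\<Sum>v\<in>V ` \<sigma>. u v *\<^sub>R v) = x"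
      using convex_hull_finite[of "V ` \<sigma>"] fin by auto
    define w where "w a = (if a \<in> \<sigma> then u (V a) else 0)" for a
    have ss: "supp w \<subseteq> \<sigma>" by (auto simp: supp_def w_def)
    then have "face_weights w" using u(1) subface[OF s] by (simp add: face_weights_def w_def)
    moreover have "sum w (arrows n) = (\<Sum>a\<in>\<sigma>. u (V a))"
      unfolding w_def using finite_arrows sub by (intro sum.mono_neutral_cong_right) auto
    then have "sum w (arrows n) = 1" using u(2) by (simp add: sum.reindex[OF inj])
    moreover have "comb w = x"
      unfolding w_def comb_restrict[OF sub] using u(3) by (simp add: sum.reindex[OF inj])
    ultimately show "x \<in> comb ` {w. face_weights w \<and> supp w \<subseteq> \<sigma> \<and> sum w (arrows n) = 1}"
      using ss by blast
  next
    fix x assume "x \<in> comb ` {w. face_weights w \<and> supp w \<subseteq> \<sigma> \<and> sum w (arrows n) = 1}"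
    then obtain w where w: "face_weights w" "supp w \<subseteq> \<sigma>" "sum w (arrows n) = 1" "x = comb w" by blast
    have out: "w a = 0" if "a \<in> arrows n - \<sigma>" for a using w(2) that by (auto simp: supp_def)
    have "sum w \<sigma> = 1"
      unfolding w(3)[symmetric] using out sub finite_arrows by (intro sum.mono_neutral_left) auto
    moreover have "comb w = (\<Sum>a\<in>\<sigma>. w a *\<^sub>R V a)"
      unfolding comb_def using out sub finite_arrows by (intro sum.mono_neutral_right) auto
    moreover have "0 \<le> w a" if "a \<in> \<sigma>" for a using w(1) sub that by (auto simp: face_weights_def)
    moreover have "(\<Sum>a\<in>\<sigma>. w a *\<^sub>R V a) \<in> convex hull (V ` \<sigma>)" if "sum w \<sigma> = 1" "\<And>a. a \<in> \<sigma> \<Longrightarrow> 0 \<le> w a"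
      by (rule convex_sum[OF fin convex_convex_hull that]) (auto intro: hull_inc)
    ultimately show "x \<in> convex hull (V ` \<sigma>)" by (simp add: w(4))
  }
qed

lemma convex_hull_face_frontier:
  assumes s: "\<sigma> \<in> \<Delta>"
  shows "convex hull (V ` \<sigma>) \<subseteq> rel_frontier (root_polytope n e)"
proof
  fix x assume x: "x \<in> convex hull (V ` \<sigma>)"
  then obtain w where w: "face_weights w" "sum w (arrows n) = 1" "x = comb w"
    unfolding convex_hull_face[OF s] by blast
  have "x \<in> root_polytope n e"
    using x hull_mono[OF image_mono[OF face_arrows[OF s]], of convex V] by (auto simp: root_polytope_def)
  moreover have "l1 x = 2" using l1_comb[OF face_weights_bipartite[OF w(1)]] w by simp
  ultimately show "x \<in> rel_frontier (root_polytope n e)" by (rule in_rel_frontier)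
qed

end

context framed_matching_complex begin

text \<open>The weights of a representation sum to at most 1, and the origin, indexed by
  \<open>None\<close>, takes the missing weight.\<close>

lemma small_l1_in_polytope:
  assumes x: "x \<in> H" "l1 x \<le> 2" and P: "0 \<in> root_polytope n e"
  shows "x \<in> root_polytope n e"
proof -
  obtain w where w: "face_weights w" "comb w = x" using fan_complete[OF x(1)] .
  have nn: "0 \<le> w a" if "a \<in> arrows n" for a using w(1) that by (simp add: face_weights_def)
  have s: "sum w (arrows n) \<le> 1" using l1_comb[OF face_weights_bipartite[OF w(1)]] w(2) x(2) by simp
  have "(\<Sum>a\<in>insert None (Some ` arrows n).
      (case a of None \<Rightarrow> 1 - sum w (arrows n) | Some a \<Rightarrow> w a) *\<^sub>R (case a of None \<Rightarrow> 0 | Some a \<Rightarrow> V a))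
      \<in> root_polytope n e"
  proof (rule convex_sum)
    show "convex (root_polytope n e)" by (simp add: root_polytope_def)
    show "(\<Sum>a\<in>insert None (Some ` arrows n). case a of None \<Rightarrow> 1 - sum w (arrows n) | Some a \<Rightarrow> w a) = 1"
      using finite_arrows by (simp add: sum.reindex)
    fix a assume a: "a \<in> insert None (Some ` arrows n)"
    then show "0 \<le> (case a of None \<Rightarrow> 1 - sum w (arrows n) | Some a \<Rightarrow> w a)" using s nn by auto
    have "V b \<in> root_polytope n e" if "b \<in> arrows n" for b
      unfolding root_polytope_def using that by (intro hull_inc imageI)
    then show "(case a of None \<Rightarrow> 0 | Some a \<Rightarrow> V a) \<in> root_polytope n e" using a P by auto
  qed (simp add: finite_arrows)
  then show ?thesis using finite_arrows w(2) by (simp add: sum.reindex comb_def)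
qed

lemma rel_frontier_l1:
  assumes x: "x \<in> rel_frontier (root_polytope n e)"
  shows "x \<in> H" "l1 x = 2"
proof -
  have xP: "x \<in> root_polytope n e" and notint: "x \<notin> rel_interior (root_polytope n e)"
    using x compact_imp_closed[OF compact_root_polytope] by (auto simp: rel_frontier_def closure_closed)
  show "x \<in> H" using xP root_polytope_subset_H by blast
  show "l1 x = 2"
  proof (rule ccontr)
    assume "l1 x \<noteq> 2"
    then have lt: "l1 x < 2" using l1_le_2[OF xP] by simp
    have "continuous_on UNIV l1" unfolding l1_def by (intro continuous_intros)
    then have op: "open {y. l1 y < 2}" using open_Collect_less[of l1 "\<lambda>_. 2"] by simp
    have "affine hull root_polytope n e \<subseteq> H"
      using root_polytope_subset_H unfolding H_def
      by (intro hull_minimal subspace_imp_affine subspace_span)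
    then have "{y. l1 y < 2} \<inter> affine hull root_polytope n e \<subseteq> root_polytope n e"
      using small_l1_in_polytope root_polytope_nonempty[OF xP] by force
    then have "x \<in> rel_interior (root_polytope n e)"
      unfolding mem_rel_interior using op lt xP by blast
    then show False using notint by blast
  qed
qed

text \<open>A common point has one representation, so its support lies in both faces.\<close>

lemma convex_hull_Int:
  assumes s: "\<sigma> \<in> \<Delta>" and t: "\<tau> \<in> \<Delta>"
  shows "convex hull (V ` \<sigma>) \<inter> convex hull (V ` \<tau>) = convex hull (V ` (\<sigma> \<inter> \<tau>))"
proof
  have st: "\<sigma> \<inter> \<tau> \<in> \<Delta>" using subface[OF s] by blast
  show "convex hull (V ` \<sigma>) \<inter> convex hull (V ` \<tau>) \<subseteq> convex hull (V ` (\<sigma> \<inter> \<tau>))"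
  proof
    fix x assume "x \<in> convex hull (V ` \<sigma>) \<inter> convex hull (V ` \<tau>)"
    then obtain w w' where w: "face_weights w" "supp w \<subseteq> \<sigma>" "sum w (arrows n) = 1" "x = comb w"
      and w': "face_weights w'" "supp w' \<subseteq> \<tau>" "x = comb w'"
      unfolding convex_hull_face[OF s] convex_hull_face[OF t] by blast
    have "w a = w' a" if "a \<in> arrows n" for a
      by (rule comb_unique[OF w(1) w'(1) _ that]) (use w w' in simp)
    then have "supp w = supp w'" by (auto simp: supp_def)
    then have "supp w \<subseteq> \<sigma> \<inter> \<tau>" using w(2) w'(2) by blast
    then show "x \<in> convex hull (V ` (\<sigma> \<inter> \<tau>))"
      unfolding convex_hull_face[OF st] using w by blast
  qed
qed (simp add: hull_mono image_mono)

lemma represents: "represents_triangulation n e \<Delta>"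
  unfolding represents_triangulation_def
proof (intro conjI ballI)
  have indep: "\<not> affine_dependent (V ` \<sigma>)" if "\<sigma> \<in> \<Delta>" for \<sigma>
    using independent_face[OF that] affine_dependent_imp_dependent by blast
  then show "\<not> affine_dependent (V ` \<sigma>)" if "\<sigma> \<in> \<Delta>" for \<sigma> using that .
  show "triangulation ((\<lambda>\<sigma>. convex hull (V ` \<sigma>)) ` \<Delta>)"
    unfolding triangulation_def
  proof (intro conjI ballI allI impI)
    show "finite ((\<lambda>\<sigma>. convex hull (V ` \<sigma>)) ` \<Delta>)" using finite_complex by blast
    fix T assume "T \<in> (\<lambda>\<sigma>. convex hull (V ` \<sigma>)) ` \<Delta>"
    then obtain \<sigma> where s: "\<sigma> \<in> \<Delta>" "T = convex hull (V ` \<sigma>)" by blast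
    then have "int (card (V ` \<sigma>)) - 1 simplex T"
      unfolding simplex_def using indep by (intro exI[of _ "V ` \<sigma>"]) auto
    then show "\<exists>k. k simplex T" by blast
  next
    fix T T' assume "T \<in> (\<lambda>\<sigma>. convex hull (V ` \<sigma>)) ` \<Delta> \<and> T' \<in> (\<lambda>\<sigma>. convex hull (V ` \<sigma>)) ` \<Delta>"
    then obtain \<sigma> \<tau> where st: "\<sigma> \<in> \<Delta>" "\<tau> \<in> \<Delta>" "T = convex hull (V ` \<sigma>)" "T' = convex hull (V ` \<tau>)"
      by blast
    have "V ` (\<sigma> \<inter> \<tau>) \<subseteq> V ` \<sigma>" by blast
    then show "T \<inter> T' face_of T"
      unfolding st(3,4) convex_hull_Int[OF st(1,2)]
      using face_of_convex_hull_affine_independent[OF indep[OF st(1)]] by blast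
  qed
  show "(\<Union>\<sigma>\<in>\<Delta>. convex hull (V ` \<sigma>)) = rel_frontier (root_polytope n e)"
  proof (intro equalityI UN_least convex_hull_face_frontier subsetI)
    fix x assume x: "x \<in> rel_frontier (root_polytope n e)"
    obtain w where w: "face_weights w" "comb w = x" using fan_complete[OF rel_frontier_l1(1)[OF x]] .
    have "sum w (arrows n) = 1" using l1_comb[OF face_weights_bipartite[OF w(1)]] w(2) rel_frontier_l1(2)[OF x] by simp
    moreover have "supp w \<in> \<Delta>" using w(1) by (simp add: face_weights_def)
    ultimately have "x \<in> convex hull (V ` supp w)"
      using w by (auto simp: convex_hull_face)
    then show "x \<in> (\<Union>\<sigma>\<in>\<Delta>. convex hull (V ` \<sigma>))" using \<open>supp w \<in> \<Delta>\<close> by blast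
  qed
qed

end

section \<open>Necessity of the axioms\<close>

context orthonormal_frame begin

lemma comb_in_rel_frontier:
  assumes w: "bipartite_weights w" and s: "sum w (arrows n) = 1"
  shows "comb w \<in> rel_frontier (root_polytope n e)"
proof (rule in_rel_frontier)
  show "comb w \<in> root_polytope n e"
    unfolding comb_def
  proof (rule convex_sum[OF finite_arrows _ s])
    show "convex (root_polytope n e)" by (simp add: root_polytope_def)
    fix a assume a: "a \<in> arrows n"
    then show "0 \<le> w a" using w by (simp add: bipartite_weights_def)
    show "V a \<in> root_polytope n e" using a by (auto simp: root_polytope_def intro: hull_inc)
  qed
qed (simp add: l1_comb[OF w] s)

definition uniform_weights :: "arrow set \<Rightarrow> arrow \<Rightarrow> real" where
  "uniform_weights \<sigma> a = of_bool (a \<in> \<sigma>) / card \<sigma>"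

lemma uniform_weights:
  assumes s: "\<sigma> \<subseteq> arrows n" "\<sigma> \<noteq> {}"
  shows "supp (uniform_weights \<sigma>) = \<sigma>" "sum (uniform_weights \<sigma>) (arrows n) = 1"
    "comb (uniform_weights \<sigma>) = (1 / card \<sigma>) *\<^sub>R (\<Sum>a\<in>\<sigma>. V a)"
proof -
  have fin: "finite \<sigma>" using s(1) finite_arrows finite_subset by blast
  then have c: "card \<sigma> > 0" using s(2) by (simp add: card_gt_0_iff)
  show "supp (uniform_weights \<sigma>) = \<sigma>"
    using s(1) c by (auto simp: supp_def uniform_weights_def)
  have "sum (uniform_weights \<sigma>) (arrows n) = (\<Sum>a\<in>\<sigma>. 1 / card \<sigma>)"
    unfolding uniform_weights_def using s(1) finite_arrows
    by (intro sum.mono_neutral_cong_right) auto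
  then show "sum (uniform_weights \<sigma>) (arrows n) = 1" using c by simp
  have "comb (uniform_weights \<sigma>) = (\<Sum>a\<in>\<sigma>. (1 / card \<sigma>) *\<^sub>R V a)"
    unfolding uniform_weights_def comb_def using s(1) finite_arrows
    by (intro sum.mono_neutral_cong_right) auto
  then show "comb (uniform_weights \<sigma>) = (1 / card \<sigma>) *\<^sub>R (\<Sum>a\<in>\<sigma>. V a)"
    by (simp add: scaleR_sum_right)
qed

lemma uniform_weights_bipartite:
  assumes "\<sigma> \<subseteq> arrows n" "\<sigma> \<noteq> {}" "fst ` \<sigma> \<inter> snd ` \<sigma> = {}"
  shows "bipartite_weights (uniform_weights \<sigma>)"
  using assms uniform_weights(1)[OF assms(1,2)]
  by (simp add: bipartite_weights_def uniform_weights_def)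

text \<open>The barycentre depends on the sets of tails and heads alone, so matchings competing for
  the same \<open>I\<close> and \<open>J\<close> share it.\<close>

lemma comb_uniform_matching:
  assumes "\<sigma> \<subseteq> arrows n" "\<sigma> \<noteq> {}" "inj_on fst \<sigma>" "inj_on snd \<sigma>"
  shows "comb (uniform_weights \<sigma>) =
    (1 / card \<sigma>) *\<^sub>R ((\<Sum>v\<in>snd ` \<sigma>. e v) - (\<Sum>v\<in>fst ` \<sigma>. e v))"
  unfolding uniform_weights(3)[OF assms(1,2)]
  by (simp add: sum.reindex assms(3,4) arrow_vertex_def split_def sum_subtractf)

text \<open>This is the edge bound for forests: all the arrow vectors lie in the span of the
  differences from one fixed vertex, one fewer than there are vertices.\<close>

lemma card_independent_arrows:
  assumes F: "F \<subseteq> arrows n" "F \<noteq> {}" and indep: "independent (V ` F)"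
  shows "card F < card (fst ` F) + card (snd ` F)"
proof -
  have fin: "finite F" using F(1) finite_arrows finite_subset by blast
  obtain v0 where v0: "v0 \<in> fst ` F" using F(2) by blast
  define U where "U = fst ` F \<union> snd ` F"
  let ?D = "(\<lambda>v. e v - e v0) ` (U - {v0})"
  have d: "e v - e v0 \<in> span ?D" if "v \<in> U" for v
    using that by (cases "v = v0") (auto simp: span_zero intro!: span_base)
  have "V ` F \<subseteq> span ?D"
  proof
    fix x assume "x \<in> V ` F"
    then obtain i j where ij: "(i, j) \<in> F" "x = V (i, j)" by auto
    then have "i \<in> U" "j \<in> U" by (force simp: U_def)+
    then have "(e j - e v0) - (e i - e v0) \<in> span ?D" by (intro span_diff d)
    then show "x \<in> span ?D" by (simp add: ij(2) V_pair)
  qed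
  then have "card (V ` F) \<le> card ?D"
    using independent_span_bound[OF _ indep, of ?D] fin by (simp add: U_def)
  also have "\<dots> \<le> card (U - {v0})" using fin by (intro card_image_le) (simp add: U_def)
  also have "\<dots> < card U" using v0 fin by (intro card_Diff1_less) (auto simp: U_def)
  also have "\<dots> \<le> card (fst ` F) + card (snd ` F)" unfolding U_def by (rule card_Un_le)
  finally show ?thesis using card_image[OF inj_on_subset[OF inj_V F(1)]] by simp
qed

end

lemma double_card_image_le:
  assumes "finite F" and partner: "\<And>a. a \<in> F \<Longrightarrow> \<exists>b\<in>F. b \<noteq> a \<and> f b = f a"
  shows "2 * card (f ` F) \<le> card F"
proof -
  have "2 \<le> card {a \<in> F. f a = y}" if y: "y \<in> f ` F" for y
  proof -
    obtain a where a: "a \<in> F" "f a = y" using y by blast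
    obtain b where b: "b \<in> F" "b \<noteq> a" "f b = f a" using partner[OF a(1)] by blast
    have "card {a, b} \<le> card {a \<in> F. f a = y}"
      using a b assms(1) by (intro card_mono) auto
    then show ?thesis using b(2) by simp
  qed
  then have "(\<Sum>y\<in>f ` F. 2) \<le> (\<Sum>y\<in>f ` F. card {a \<in> F. f a = y})"
    by (intro sum_mono) auto
  also have "\<dots> = card F"
    using sum.group[OF assms(1) finite_imageI[OF assms(1)], of f f "\<lambda>_. 1 :: nat"] by simp
  finally show ?thesis by simp
qed

section \<open>Support axiom from carriers of barycentres\<close>

locale triangulated_complex = framed_complex n \<Delta> e
  for n \<Delta> and e :: "nat \<Rightarrow> 'v::euclidean_space" +
  assumes rep: "represents_triangulation n e \<Delta>"
begin

lemma affine_independent_face: "\<sigma> \<in> \<Delta> \<Longrightarrow> \<not> affine_dependent (V ` \<sigma>)"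
  using rep by (simp add: represents_triangulation_def)

text \<open>The sum of the coordinates at the heads is 1 on every vector of the face. Hence the
  coefficients of any linear relation sum to zero, and the relation is an affine one.\<close>

lemma independent_face:
  assumes s: "\<sigma> \<in> \<Delta>"
  shows "independent (V ` \<sigma>)"
proof
  assume "dependent (V ` \<sigma>)"
  have fin: "finite (V ` \<sigma>)" using finite_face[OF s] by simp
  obtain u where u: "\<exists>v\<in>V ` \<sigma>. u v \<noteq> 0" "(\<Sum>v\<in>V ` \<sigma>. u v *\<^sub>R v) = 0"
    using dependent_finite[OF fin] \<open>dependent (V ` \<sigma>)\<close> by auto
  define f where "f x = (\<Sum>v\<in>snd ` \<sigma>. x \<bullet> e v)" for x :: 'v
  have fV: "f x = 1" if "x \<in> V ` \<sigma>" for x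
  proof -
    obtain a where a: "a \<in> \<sigma>" "x = V a" using \<open>x \<in> V ` \<sigma>\<close> by blast
    then have an: "a \<in> arrows n" using face_arrows[OF s] by blast
    have "fst a \<notin> snd ` \<sigma>" using tails_heads_disjoint[OF s] a(1) by blast
    then have "f x = (\<Sum>v\<in>snd ` \<sigma>. if snd a = v then 1 else 0)"
      unfolding f_def a(2) using vertices_face(2)[OF s]
      by (intro sum.cong refl) (auto simp: V_coord[OF an subsetD])
    then show ?thesis using a(1) finite_face[OF s] by simp
  qed
  have "sum u (V ` \<sigma>) = (\<Sum>x\<in>V ` \<sigma>. u x * f x)" by (intro sum.cong refl) (simp add: fV)
  also have "\<dots> = f (\<Sum>x\<in>V ` \<sigma>. u x *\<^sub>R x)"
    unfolding f_def inner_sum_left sum_distrib_left by (subst sum.swap) simp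
  also have "\<dots> = 0" by (simp add: u(2) f_def)
  finally show False
    using affine_dependent_explicit_finite[OF fin] u affine_independent_face[OF s] by blast
qed

text \<open>Full support puts the point in the relative interior of the simplex of
  \<open>\<sigma>\<close>. The intersection with the simplex of \<open>\<tau>\<close> is a face
  containing it, hence all of the simplex of \<open>\<sigma>\<close>, whose extreme points are then
  extreme points of the other.\<close>

lemma carrier_subset:
  assumes s: "\<sigma> \<in> \<Delta>" and t: "\<tau> \<in> \<Delta>"
    and w: "face_weights w" "supp w = \<sigma>" "sum w (arrows n) = 1" and x: "comb w \<in> convex hull (V ` \<tau>)"
  shows "\<sigma> \<subseteq> \<tau>"
proof -
  note sub = face_arrows[OF s]
  have inj: "inj_on V \<sigma>" using inj_V sub by (rule inj_on_subset)
  define u where "u v = w (inv_into \<sigma> V v)" for v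
  have uV: "u (V a) = w a" if "a \<in> \<sigma>" for a using that inj by (simp add: u_def)
  have pos: "w a > 0" if "a \<in> \<sigma>" for a
    using that w(1,2) by (fastforce simp: supp_def face_weights_def order.order_iff_strict)
  have "sum w \<sigma> = 1"
    unfolding w(3)[symmetric] using w(2) sub finite_arrows
    by (intro sum.mono_neutral_left) (auto simp: supp_def)
  then have "sum u (V ` \<sigma>) = 1" using uV by (simp add: sum.reindex[OF inj])
  moreover have "(\<Sum>v\<in>V ` \<sigma>. u v *\<^sub>R v) = comb w"
    using uV by (simp add: sum.reindex[OF inj] comb_supp[of w] w(2))
  ultimately have ri: "comb w \<in> rel_interior (convex hull (V ` \<sigma>))"
    unfolding rel_interior_convex_hull_explicit[OF affine_independent_face[OF s]]
    using pos uV by (intro CollectI exI[of _ u]) auto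
  let ?F = "convex hull (V ` \<sigma>) \<inter> convex hull (V ` \<tau>)"
  have faces: "?F face_of convex hull (V ` \<sigma>)" "?F face_of convex hull (V ` \<tau>)"
    using rep s t unfolding represents_triangulation_def triangulation_def
    by (blast, metis (no_types, lifting) Int_commute imageI)
  have "convex hull (V ` \<sigma>) \<subseteq> ?F"
    by (rule subset_of_face_of[OF faces(1) order_refl])
      (use ri x rel_interior_subset[of "convex hull (V ` \<sigma>)"] in blast)
  then have face: "convex hull (V ` \<sigma>) face_of convex hull (V ` \<tau>)"
    using faces(2) by (simp add: Int_absorb2)
  show ?thesis
  proof
    fix a assume a: "a \<in> \<sigma>"
    then have "V a extreme_point_of convex hull (V ` \<sigma>)"
      using extreme_point_of_convex_hull_affine_independent[OF affine_independent_face[OF s]] by blast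
    then have "V a extreme_point_of convex hull (V ` \<tau>)"
      using extreme_point_of_face[OF face] by blast
    then have "V a \<in> V ` \<tau>"
      using extreme_point_of_convex_hull_affine_independent[OF affine_independent_face[OF t]] by blast
    then show "a \<in> \<tau>"
      using inj_on_image_mem_iff[OF inj_V _ face_arrows[OF t], of a] a sub by blast
  qed
qed

lemma uniform_weights_face:
  assumes "\<sigma> \<in> \<Delta>" "\<sigma> \<noteq> {}"
  shows "face_weights (uniform_weights \<sigma>)"
  using assms uniform_weights(1)[OF face_arrows[OF assms(1)] assms(2)]
  by (simp add: face_weights_def uniform_weights_def)

lemma frontier_weights:
  assumes "x \<in> rel_frontier (root_polytope n e)"
  obtains \<tau> w where "\<tau> \<in> \<Delta>" "x \<in> convex hull (V ` \<tau>)" "face_weights w" "supp w \<subseteq> \<tau>"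
    "sum w (arrows n) = 1" "comb w = x"
proof -
  have "x \<in> (\<Union>\<sigma>\<in>\<Delta>. convex hull (V ` \<sigma>))"
    using rep assms by (simp add: represents_triangulation_def)
  then obtain \<tau> where t: "\<tau> \<in> \<Delta>" "x \<in> convex hull (V ` \<tau>)" by blast
  then obtain w where "face_weights w" "supp w \<subseteq> \<tau>" "sum w (arrows n) = 1" "comb w = x"
    unfolding convex_hull_face[OF t(1)] by blast
  then show ?thesis using that t by blast
qed

lemma matching_unique:
  assumes s: "\<sigma> \<in> \<Delta>" "inj_on fst \<sigma>" "inj_on snd \<sigma>" and t: "\<tau> \<in> \<Delta>" "inj_on fst \<tau>" "inj_on snd \<tau>"
    and eq: "fst ` \<sigma> = fst ` \<tau>" "snd ` \<sigma> = snd ` \<tau>" and ne: "\<sigma> \<noteq> {}"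
  shows "\<sigma> \<subseteq> \<tau>"
proof (rule carrier_subset[OF s(1) t(1) uniform_weights_face[OF s(1) ne]])
  note a = face_arrows[OF s(1)] face_arrows[OF t(1)]
  have ne': "\<tau> \<noteq> {}" using ne eq by auto
  show "supp (uniform_weights \<sigma>) = \<sigma>" "sum (uniform_weights \<sigma>) (arrows n) = 1"
    by (rule uniform_weights[OF a(1) ne])+
  have "card \<sigma> = card \<tau>" using card_image[OF s(2)] card_image[OF t(2)] eq(1) by simp
  then have "comb (uniform_weights \<sigma>) = comb (uniform_weights \<tau>)"
    by (simp only: comb_uniform_matching[OF a(1) ne s(2,3)] comb_uniform_matching[OF a(2) ne' t(2,3)] eq)
  then show "comb (uniform_weights \<sigma>) \<in> convex hull (V ` \<tau>)"
    unfolding convex_hull_face[OF t(1)]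
    using uniform_weights_face[OF t(1) ne'] uniform_weights[OF a(2) ne'] by blast
qed

text \<open>
  The barycentre of any bijection between \<open>I\<close> and \<open>J\<close> lies in some face. Arrows of weight other than
  \<open>1 / card I\<close> would come in pairs at each of their ends, too many to be independent.
\<close>

lemma matching_exists:
  assumes IJ: "I \<subseteq> vertices n" "J \<subseteq> vertices n" "I \<inter> J = {}" "card I = card J" and ne: "I \<noteq> {}"
  obtains \<sigma> where "\<sigma> \<in> \<Delta>" "inj_on fst \<sigma>" "inj_on snd \<sigma>" "fst ` \<sigma> = I" "snd ` \<sigma> = J"
proof -
  have fin: "finite I" "finite J" using IJ finite_vertices finite_subset by blast+
  obtain h where h: "bij_betw h I J" using finite_same_card_bij[OF fin IJ(4)] by blast
  define G where "G = (\<lambda>i. (i, h i)) ` I"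
  have Gf: "fst ` G = I" "snd ` G = J" "inj_on fst G" "inj_on snd G" "G \<noteq> {}"
    using h ne by (auto simp: G_def image_image bij_betw_def inj_on_def)
  have "G \<subseteq> I \<times> J" using Gf(1,2) by force
  moreover have "I \<times> J \<subseteq> arrows n"
    using IJ(1-3) unfolding vertices_def arrows_def by blast
  ultimately have Ga: "G \<subseteq> arrows n" by (rule order.trans)
  have cG: "card G = card I" using card_image[OF Gf(3)] Gf(1) by simp
  \<comment> \<open>The absolute value of every coordinate of the barycentre on
    \<open>I \<union> J\<close>, hence the total weight that any representation has at each of these
    vertices.\<close>
  define c where "c = 1 / real (card I)"
  have c: "c > 0" using ne fin by (simp add: c_def card_gt_0_iff)
  note uG = uniform_weights[OF Ga Gf(5)]
  have bG: "bipartite_weights (uniform_weights G)"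
    by (rule uniform_weights_bipartite[OF Ga Gf(5)]) (simp add: Gf IJ)
  define x where "x = comb (uniform_weights G)"
  have "x \<in> rel_frontier (root_polytope n e)"
    unfolding x_def by (rule comb_in_rel_frontier[OF bG uG(2)])
  then obtain \<tau> w where w: "face_weights w" "comb w = x" by (rule frontier_weights)
  have bw: "bipartite_weights w" by (rule face_weights_bipartite[OF w(1)])
  have pat: "sign_pattern I J (comb w)"
    using comb_sign_pattern[OF bG] by (simp add: uG(1) Gf w(2) x_def)
  define \<sigma> where "\<sigma> = supp w"
  have sD: "\<sigma> \<in> \<Delta>" using w(1) by (simp add: \<sigma>_def face_weights_def)
  note sIJ = supp_sign_pattern[OF bw pat IJ(1,2), folded \<sigma>_def]
  have x_eq: "x = c *\<^sub>R ((\<Sum>v\<in>J. e v) - (\<Sum>v\<in>I. e v))"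
    unfolding x_def comb_uniform_matching[OF Ga Gf(5,3,4)] by (simp add: Gf cG c_def)
  have e_sum: "(\<Sum>v\<in>A. e v) \<bullet> e u = of_bool (u \<in> A)" if "A \<subseteq> vertices n" "u \<in> vertices n" for A u
  proof -
    have "(\<Sum>v\<in>A. e v) \<bullet> e u = (\<Sum>v\<in>A. if v = u then 1 else 0)"
      unfolding inner_sum_left using that by (intro sum.cong refl orth) auto
    then show ?thesis using finite_subset[OF that(1) finite_vertices] by simp
  qed
  have pos: "w a > 0" if "a \<in> \<sigma>" for a
    using that w(1) by (fastforce simp: \<sigma>_def supp_def face_weights_def order.order_iff_strict)
  have tail: "(\<Sum>b\<in>{b \<in> \<sigma>. fst b = fst a}. w b) = c" if a: "a \<in> \<sigma>" for a
  proof -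
    have "fst a \<in> I" "fst a \<notin> J" "fst a \<in> vertices n" using sIJ(2) a IJ by auto
    then show ?thesis
      using comb_tail[OF bw, of a] a w(2) IJ by (simp add: \<sigma>_def x_eq inner_diff_left e_sum)
  qed
  have head: "(\<Sum>b\<in>{b \<in> \<sigma>. snd b = snd a}. w b) = c" if a: "a \<in> \<sigma>" for a
  proof -
    have "snd a \<in> J" "snd a \<notin> I" "snd a \<in> vertices n" using sIJ(3) a IJ by auto
    then show ?thesis
      using comb_head[OF bw, of a] a w(2) IJ by (simp add: \<sigma>_def x_eq inner_diff_left e_sum)
  qed
  have fs: "finite \<sigma>" by (rule finite_face[OF sD])
  have two: "w a + w b \<le> c" if ab: "a \<in> \<sigma>" "b \<in> \<sigma>" "a \<noteq> b" "f b = f a"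
    and f: "(\<Sum>b\<in>{b \<in> \<sigma>. f b = f a}. w b) = c" for a b and f :: "arrow \<Rightarrow> nat"
  proof -
    have "sum w {a, b} \<le> (\<Sum>b\<in>{b \<in> \<sigma>. f b = f a}. w b)"
      using ab fs pos by (intro sum_mono2) (auto intro: less_imp_le)
    then show ?thesis using ab(3) f by simp
  qed
  define F where "F = {a \<in> \<sigma>. w a \<noteq> c}"
  \<comment> \<open>An arrow alone at its end carries the whole \<open>c\<close>, so one of
    \<open>F\<close> shares its end. Both weights being positive with sum at most \<open>c\<close>,
    the other arrow is in \<open>F\<close> as well.\<close>
  have partner: "\<exists>b\<in>F. b \<noteq> a \<and> f b = f a" if a: "a \<in> F"
    and f: "(\<Sum>b\<in>{b \<in> \<sigma>. f b = f a}. w b) = c" for a and f :: "arrow \<Rightarrow> nat"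
  proof -
    have as: "a \<in> \<sigma>" using a by (simp add: F_def)
    have "\<exists>b\<in>\<sigma>. b \<noteq> a \<and> f b = f a"
    proof (rule ccontr)
      assume "\<not> ?thesis"
      then have "{b \<in> \<sigma>. f b = f a} = {a}" using as by auto
      then show False using f a by (simp add: F_def)
    qed
    then obtain b where b: "b \<in> \<sigma>" "b \<noteq> a" "f b = f a" by blast
    then have "w b < c" using two[of a b f] as f pos[OF as] by simp
    then have "b \<in> F" using b(1) by (simp add: F_def)
    then show ?thesis using b by blast
  qed
  have "F = {}"
  proof (rule ccontr)
    assume ne: "F \<noteq> {}"
    have Fs: "F \<subseteq> \<sigma>" by (auto simp: F_def)
    \<comment> \<open>Together these make tails and heads of \<open>F\<close> at most
      \<open>card F\<close> in number, against the bound for independent arrows.\<close>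
    have "2 * card (fst ` F) \<le> card F" "2 * card (snd ` F) \<le> card F"
      using fs Fs partner tail head
      by (intro double_card_image_le; blast intro: finite_subset)+
    moreover have "card F < card (fst ` F) + card (snd ` F)"
      by (rule card_independent_arrows[OF _ ne])
        (use Fs face_arrows[OF sD] independent_mono[OF independent_face[OF sD]] in blast)+
    ultimately show False by simp
  qed
  then have wc: "w a = c" if "a \<in> \<sigma>" for a using that unfolding F_def by blast
  have inj: "inj_on f \<sigma>" if f: "\<And>a. a \<in> \<sigma> \<Longrightarrow> (\<Sum>b\<in>{b \<in> \<sigma>. f b = f a}. w b) = c" for f :: "arrow \<Rightarrow> nat"
  proof (rule inj_onI, rule ccontr)
    fix a b assume ab: "a \<in> \<sigma>" "b \<in> \<sigma>" "f a = f b" "a \<noteq> b"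
    then have "w a + w b \<le> c" using two[of a b f] f by simp
    then show False using wc[OF ab(1)] wc[OF ab(2)] c by simp
  qed
  have "inj_on fst \<sigma>" by (rule inj[OF tail])
  moreover have "inj_on snd \<sigma>" by (rule inj[OF head])
  ultimately show ?thesis using that sD sIJ by blast
qed

lemma SA_holds: "SA n (matching_faces \<Delta>)"
  unfolding SA_def
proof (intro allI impI)
  fix I J assume "I \<subseteq> {1..n+1} \<and> J \<subseteq> {1..n+1} \<and> I \<inter> J = {} \<and> card I = card J"
  then have IJ: "I \<subseteq> vertices n" "J \<subseteq> vertices n" "I \<inter> J = {}" "card I = card J"
    by (simp_all add: vertices_def)
  have fin: "finite I" "finite J" using IJ finite_vertices finite_subset by blast+
  show "\<exists>!\<sigma>. \<sigma> \<in> matching_faces \<Delta> \<and> \<sigma> \<subseteq> I \<times> J \<and> card \<sigma> = card I"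
  proof (cases "I = {}")
    case True
    then show ?thesis by (intro ex1I[of _ "{}"]) (auto simp: matching_faces_iff empty_face)
  next
    case False
    obtain \<sigma> where s: "\<sigma> \<in> \<Delta>" "inj_on fst \<sigma>" "inj_on snd \<sigma>" "fst ` \<sigma> = I" "snd ` \<sigma> = J"
      using matching_exists[OF IJ False] .
    show ?thesis
    proof (rule ex1I[of _ \<sigma>])
      have "\<sigma> \<subseteq> fst ` \<sigma> \<times> snd ` \<sigma>" by force
      then show "\<sigma> \<in> matching_faces \<Delta> \<and> \<sigma> \<subseteq> I \<times> J \<and> card \<sigma> = card I"
        using s card_image[OF s(2)] by (simp add: matching_faces_iff)
      fix \<tau> assume t: "\<tau> \<in> matching_faces \<Delta> \<and> \<tau> \<subseteq> I \<times> J \<and> card \<tau> = card I"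
      then have t': "\<tau> \<in> \<Delta>" "inj_on fst \<tau>" "inj_on snd \<tau>" by (simp_all add: matching_faces_iff)
      have "fst ` \<tau> \<subseteq> I" "snd ` \<tau> \<subseteq> J" using t by auto
      then have ft: "fst ` \<tau> = I" "snd ` \<tau> = J"
        using fin t IJ(4) card_image[OF t'(2)] card_image[OF t'(3)] by (simp_all add: card_subset_eq)
      have "\<tau> \<noteq> {}" "\<sigma> \<noteq> {}" using ft s(4) False by auto
      then show "\<tau> = \<sigma>"
        using matching_unique[OF t' s(1-3)] matching_unique[OF s(1-3) t'] ft s(4,5) by blast
    qed
  qed
qed

end

lemma inj_on_exchange:
  assumes "inj_on f A" "a \<in> A" "f b = f a \<or> f b \<notin> f ` A"
  shows "inj_on f (insert b (A - {a}))"
  unfolding inj_on_insert using assms by (auto simp: inj_on_def)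

section \<open>Linkage axiom from points near a barycentre\<close>

context triangulated_complex begin

text \<open>
  Shifting a little of the weight of every tail of \<open>\<sigma>\<close> to \<open>k\<close> moves the barycentre of \<open>\<sigma>\<close> into a face
  that still contains \<open>\<sigma>\<close> and has an arrow with tail \<open>k\<close>.
\<close>

lemma exchange_tail:
  assumes s: "\<sigma> \<in> \<Delta>" "inj_on fst \<sigma>" "inj_on snd \<sigma>" "\<sigma> \<noteq> {}"
    and k: "k \<in> vertices n" "k \<notin> fst ` \<sigma>" "k \<notin> snd ` \<sigma>"
  obtains i j where "(i, j) \<in> \<sigma>" "insert (k, j) (\<sigma> - {(i, j)}) \<in> \<Delta>"
proof -
  note sa = face_arrows[OF s(1)]
  \<comment> \<open>Mixing in the barycentre of this star makes the coordinate at \<open>k\<close>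
    negative without introducing a new head.\<close>
  define \<rho> where "\<rho> = {k} \<times> snd ` \<sigma>"
  have kr: "(k, v) \<in> arrows n" if "v \<in> snd ` \<sigma>" for v
  proof -
    have "v \<in> vertices n" "v \<noteq> k" using vertices_face(2)[OF s(1)] that k(3) by auto
    then show ?thesis using k(1) by (simp add: arrows_iff vertices_def)
  qed
  then have ra: "\<rho> \<subseteq> arrows n" by (auto simp: \<rho>_def)
  have rne: "\<rho> \<noteq> {}" using s(4) by (auto simp: \<rho>_def)
  note us = uniform_weights[OF sa s(4)] and ur = uniform_weights[OF ra rne]
  define w where "w t a = (1 - t) * uniform_weights \<sigma> a + t * uniform_weights \<rho> a" for t a
  have comb_w: "comb (w t) = comb (uniform_weights \<sigma>) +
      t *\<^sub>R (comb (uniform_weights \<rho>) - comb (uniform_weights \<sigma>))" for t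
    by (simp add: comb_def w_def algebra_simps scaleR_sum_right sum.distrib sum_subtractf)
  have sum_w: "sum (w t) (arrows n) = 1" for t
    by (simp add: w_def sum.distrib us(2) ur(2) flip: sum_distrib_left)
  have un: "0 \<le> uniform_weights A a" for A a by (simp add: uniform_weights_def)
  have supp_w: "supp (w t) = \<sigma> \<union> \<rho>" if "0 < t" "t < 1" for t
  proof -
    have "w t a = 0 \<longleftrightarrow> uniform_weights \<sigma> a = 0 \<and> uniform_weights \<rho> a = 0" for a
      using un that by (simp add: w_def add_nonneg_eq_0_iff)
    then have "supp (w t) = supp (uniform_weights \<sigma>) \<union> supp (uniform_weights \<rho>)"
      by (auto simp: supp_def)
    then show ?thesis by (simp add: us(1) ur(1))
  qed
  have ends: "fst ` (\<sigma> \<union> \<rho>) = insert k (fst ` \<sigma>)" "snd ` (\<sigma> \<union> \<rho>) = snd ` \<sigma>"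
    using s(4) by (auto simp: \<rho>_def image_Un)
  have bw: "bipartite_weights (w t)" if "0 < t" "t < 1" for t
    using that un tails_heads_disjoint[OF s(1)] k(3)
    by (simp add: bipartite_weights_def supp_w ends) (simp add: w_def)
  define x0 where "x0 = comb (uniform_weights \<sigma>)"
  \<comment> \<open>The hulls that miss \<open>x0\<close> form a closed set, so points near
    \<open>x0\<close> lie only in hulls containing \<open>x0\<close>, and by
    \<open>carrier_subset\<close> the faces of these contain \<open>\<sigma>\<close>.\<close>
  define U where "U = (\<Union>\<tau>\<in>{\<tau> \<in> \<Delta>. x0 \<notin> convex hull (V ` \<tau>)}. convex hull (V ` \<tau>))"
  have "closed U"
    unfolding U_def using finite_complex finite_face
    by (intro closed_UN ballI compact_imp_closed finite_imp_compact_convex_hull finite_imageI) auto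
  moreover have "x0 \<notin> U" by (auto simp: U_def)
  ultimately have nb: "open (- U)" "x0 \<in> - U" by auto
  have "((\<lambda>t. comb (w t)) \<longlongrightarrow> x0 + 0 *\<^sub>R (comb (uniform_weights \<rho>) - x0)) (at_right 0)"
    unfolding comb_w x0_def by (intro tendsto_intros)
  then have "\<forall>\<^sub>F t in at_right 0. comb (w t) \<in> - U"
    using topological_tendstoD[OF _ nb] by simp
  moreover have "\<forall>\<^sub>F t :: real in at_right 0. t < 1"
    by (intro order_tendstoD(2)[OF tendsto_ident_at]) auto
  moreover have "\<forall>\<^sub>F t :: real in at_right 0. 0 < t" by (rule eventually_at_right_less)
  ultimately have "\<forall>\<^sub>F t in at_right 0. 0 < t \<and> t < 1 \<and> comb (w t) \<in> - U"
    by eventually_elim simp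
  then obtain t where t: "0 < t" "t < 1" "comb (w t) \<in> - U"
    using eventually_happens'[OF trivial_limit_at_right_real] by blast
  note b = bw[OF t(1,2)]
  obtain \<tau> u where u: "\<tau> \<in> \<Delta>" "comb (w t) \<in> convex hull (V ` \<tau>)"
      "face_weights u" "supp u \<subseteq> \<tau>" "comb u = comb (w t)"
    using frontier_weights[OF comb_in_rel_frontier[OF b sum_w]] .
  then have "x0 \<in> convex hull (V ` \<tau>)" using t(3) by (auto simp: U_def)
  then have st: "\<sigma> \<subseteq> \<tau>"
    using carrier_subset[OF s(1) u(1) uniform_weights_face[OF s(1,4)] us(1,2)] by (simp add: x0_def)
  \<comment> \<open>The signs force an arrow with tail \<open>k\<close> in the support of
    \<open>u\<close>, and its head is a head of \<open>\<sigma>\<close>; the arrow of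
    \<open>\<sigma>\<close> with that head is the one to drop.\<close>
  have "sign_pattern (insert k (fst ` \<sigma>)) (snd ` \<sigma>) (comb u)"
    using comb_sign_pattern[OF b] by (simp only: supp_w[OF t(1,2)] ends u(5))
  then have "fst ` supp u = insert k (fst ` \<sigma>)" "snd ` supp u = snd ` \<sigma>"
    by (rule supp_sign_pattern[OF face_weights_bipartite[OF u(3)]];
        use vertices_face[OF s(1)] k(1) in simp)+
  then obtain j where j: "(k, j) \<in> supp u" "j \<in> snd ` \<sigma>" by force
  then obtain i where i: "(i, j) \<in> \<sigma>" by auto
  have "insert (k, j) (\<sigma> - {(i, j)}) \<in> \<Delta>"
    by (rule subface[OF u(1)]) (use j u(4) st in auto)
  then show ?thesis using that i by blast
qed

text \<open>Negating the basis undoes the reversal: \<open>(j, i)\<close> gets the vector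
  \<open>- e i - (- e j)\<close>, which is that of \<open>(i, j)\<close>. So the geometric complex
  and the polytope are unchanged.\<close>

lemma swap_triangulated: "triangulated_complex n ((`) prod.swap ` \<Delta>) (\<lambda>v. - e v)"
proof -
  have V: "arrow_vertex (\<lambda>v. - e v) ` prod.swap ` \<sigma> = V ` \<sigma>" for \<sigma> :: "arrow set"
    by (auto simp: image_image arrow_vertex_def split_def)
  have "arrow_vertex (\<lambda>v. - e v) ` arrows n = V ` arrows n"
  proof -
    have "prod.swap a \<in> arrows n" if "a \<in> arrows n" for a :: arrow
      using that by (cases a) (simp add: arrows_iff)
    then have "prod.swap ` arrows n = arrows n"
      by (auto intro!: image_eqI[of _ prod.swap "prod.swap _"])
    then show ?thesis using V[of "arrows n"] by simp
  qed
  then have "represents_triangulation n (\<lambda>v. - e v) ((`) prod.swap ` \<Delta>)"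
    using rep unfolding represents_triangulation_def root_polytope_def
    by (simp add: image_image V[unfolded image_image])
  moreover have "orthonormal_frame n (\<lambda>v. - e v)" by unfold_locales (simp add: orth)
  ultimately show ?thesis
    by (simp add: triangulated_complex_def triangulated_complex_axioms_def framed_complex_def swap_complex)
qed

lemma exchange_head:
  assumes s: "\<sigma> \<in> \<Delta>" "inj_on fst \<sigma>" "inj_on snd \<sigma>" "\<sigma> \<noteq> {}"
    and k: "k \<in> vertices n" "k \<notin> fst ` \<sigma>" "k \<notin> snd ` \<sigma>"
  obtains i j where "(i, j) \<in> \<sigma>" "insert (i, k) (\<sigma> - {(i, j)}) \<in> \<Delta>"
proof -
  interpret sw: triangulated_complex n "(`) prod.swap ` \<Delta>" "\<lambda>v. - e v"
    by (rule swap_triangulated)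
  have im: "fst ` prod.swap ` \<sigma> = snd ` \<sigma>" "snd ` prod.swap ` \<sigma> = fst ` \<sigma>"
    by (simp_all add: image_image)
  have inj: "inj_on fst (prod.swap ` \<sigma>)" "inj_on snd (prod.swap ` \<sigma>)"
    using s(2,3) by (auto simp: inj_on_def)
  obtain j i where ij: "(j, i) \<in> prod.swap ` \<sigma>"
    "insert (k, i) (prod.swap ` \<sigma> - {(j, i)}) \<in> (`) prod.swap ` \<Delta>"
    by (rule sw.exchange_tail[of "prod.swap ` \<sigma>" k]) (use s k inj in \<open>simp_all add: im\<close>)
  have "prod.swap ` insert (k, i) (prod.swap ` \<sigma> - {(j, i)}) = insert (i, k) (\<sigma> - {(i, j)})"
    by (force simp: image_iff)
  then show ?thesis using that[of i j] ij by (auto simp: swap_image_mem_iff)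
qed

lemma LA_holds: "LA n (matching_faces \<Delta>)"
  unfolding LA_def
proof (intro allI impI)
  fix I J \<sigma>
  assume a: "I \<subseteq> {1..n+1} \<and> J \<subseteq> {1..n+1} \<and> I \<inter> J = {} \<and> \<sigma> \<in> matching_faces \<Delta> \<and>
    \<sigma> \<noteq> {} \<and> \<sigma> \<subseteq> I \<times> J"
  then have s: "\<sigma> \<in> \<Delta>" "inj_on fst \<sigma>" "inj_on snd \<sigma>" "\<sigma> \<noteq> {}" by (simp_all add: matching_faces_iff)
  have new: "k \<in> vertices n" "k \<notin> fst ` \<sigma>" "k \<notin> snd ` \<sigma>" if "k \<in> {1..n+1} - (I \<union> J)" for k
    using a that by (auto simp: vertices_def)
  show "(\<forall>k \<in> {1..n+1} - (I \<union> J). \<exists>(i, j) \<in> \<sigma>. (\<sigma> - {(i, j)}) \<union> {(k, j)} \<in> matching_faces \<Delta>) \<and>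
        (\<forall>k \<in> {1..n+1} - (I \<union> J). \<exists>(i, j) \<in> \<sigma>. (\<sigma> - {(i, j)}) \<union> {(i, k)} \<in> matching_faces \<Delta>)"
  proof (intro conjI ballI)
    fix k assume "k \<in> {1..n+1} - (I \<union> J)"
    note k = new[OF this]
    obtain i j where ij: "(i, j) \<in> \<sigma>" "insert (k, j) (\<sigma> - {(i, j)}) \<in> \<Delta>"
      using exchange_tail[OF s k] .
    have "inj_on fst (insert (k, j) (\<sigma> - {(i, j)}))"
      by (rule inj_on_exchange[OF s(2) ij(1)]) (simp add: k(2))
    moreover have "inj_on snd (insert (k, j) (\<sigma> - {(i, j)}))"
      by (rule inj_on_exchange[OF s(3) ij(1)]) simp
    ultimately show "\<exists>(i, j) \<in> \<sigma>. (\<sigma> - {(i, j)}) \<union> {(k, j)} \<in> matching_faces \<Delta>"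
      using ij by (auto simp: matching_faces_iff intro!: bexI[of _ "(i, j)"])
  next
    fix k assume "k \<in> {1..n+1} - (I \<union> J)"
    note k = new[OF this]
    obtain i j where ij: "(i, j) \<in> \<sigma>" "insert (i, k) (\<sigma> - {(i, j)}) \<in> \<Delta>"
      using exchange_head[OF s k] .
    have "inj_on fst (insert (i, k) (\<sigma> - {(i, j)}))"
      by (rule inj_on_exchange[OF s(2) ij(1)]) simp
    moreover have "inj_on snd (insert (i, k) (\<sigma> - {(i, j)}))"
      by (rule inj_on_exchange[OF s(3) ij(1)]) (simp add: k(3))
    ultimately show "\<exists>(i, j) \<in> \<sigma>. (\<sigma> - {(i, j)}) \<union> {(i, k)} \<in> matching_faces \<Delta>"
      using ij by (auto simp: matching_faces_iff intro!: bexI[of _ "(i, j)"])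
  qed
qed

end

lemma arrow_complex_if_permissible:
  assumes p: "permissible n \<Delta>" and f: "flag_complex (arrows n) \<Delta>"
  shows "arrow_complex n \<Delta>"
proof
  note p = p[unfolded permissible_def]
  show c: "abstract_complex_on (arrows n) \<Delta>" using p by blast
  show "admissible n \<sigma>" if "\<sigma> \<in> \<Delta>" for \<sigma> using p that by blast
  have vertex: "{a} \<in> \<Delta>" if "a \<in> arrows n" for a using c that by (simp add: abstract_complex_on_def)
  have link: "{(i, j), (i, k)} \<in> \<Delta> \<and> {(j, i), (k, i)} \<in> \<Delta>"
    if "i \<in> {1..n+1}" "j \<in> {1..n+1}" "k \<in> {1..n+1}" "i \<noteq> j" "i \<noteq> k" "j \<noteq> k" for i j k
    using p that by blast
  show "{(i, j), (i, k)} \<in> \<Delta>" if "(i, j) \<in> arrows n" "(i, k) \<in> arrows n" for i j k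
    using that link[of i j k] vertex[of "(i, j)"] by (cases "j = k") (auto simp only: arrows_iff insert_absorb2)
  show "{(j, i), (k, i)} \<in> \<Delta>" if "(j, i) \<in> arrows n" "(k, i) \<in> arrows n" for i j k
    using that link[of i j k] vertex[of "(j, i)"] by (cases "j = k") (auto simp only: arrows_iff insert_absorb2)
  have exch: "\<forall>i1\<in>{1..n+1}. \<forall>i2\<in>{1..n+1}. \<forall>j1\<in>{1..n+1}. \<forall>j2\<in>{1..n+1}.
        i1 \<noteq> i2 \<and> j1 \<noteq> j2 \<and> {i1, i2} \<inter> {j1, j2} = {} \<longrightarrow>
        ({(i1, j1), (i2, j2)} \<in> \<Delta>) \<noteq> ({(i1, j2), (i2, j1)} \<in> \<Delta>)"
    using p by blast
  show "({(i1, j1), (i2, j2)} \<in> \<Delta>) \<noteq> ({(i1, j2), (i2, j1)} \<in> \<Delta>)"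
    if "(i1, j1) \<in> arrows n" "(i2, j2) \<in> arrows n" "(i1, j2) \<in> arrows n" "(i2, j1) \<in> arrows n"
      "i1 \<noteq> i2" "j1 \<noteq> j2" for i1 j1 i2 j2
    by (rule exch[rule_format]) (use that in \<open>auto simp only: arrows_iff\<close>)
  show "flag_complex (arrows n) \<Delta>" by (rule f)
qed

lemma orthonormal_frame_Basis:
  assumes "bij_betw e {1..n+1} (Basis :: 'v::euclidean_space set)"
  shows "orthonormal_frame n e"
  unfolding orthonormal_frame_def vertices_def
proof (intro allI impI)
  fix u v assume "u \<in> {1..n+1}" "v \<in> {1..n+1}"
  then have "e u \<in> Basis" "e v \<in> Basis" "e u = e v \<longleftrightarrow> u = v"
    using assms by (auto simp: bij_betw_def inj_on_eq_iff)
  then show "e u \<bullet> e v = (if u = v then 1 else 0)" by (simp add: inner_Basis)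
qed

theorem theorem3p4:
  fixes n :: nat
    and e :: "nat \<Rightarrow> real ^ 'd"
    and \<Delta> :: "arrow set set"
  assumes dimension: "CARD('d) = n + 1"
    and standard_basis: "bij_betw e {1..n+1} (Basis :: (real ^ 'd) set)"
    and permissible: "permissible n \<Delta>"
    and uniform: "uniform_flag_complex n \<Delta>"
  shows "represents_triangulation n e \<Delta> \<longleftrightarrow>
           SA n (matching_faces \<Delta>) \<and> LA n (matching_faces \<Delta>)"
proof -
  have "arrow_complex n \<Delta>"
    using arrow_complex_if_permissible permissible uniform by (simp add: uniform_flag_complex_def)
  moreover have "orthonormal_frame n e" by (rule orthonormal_frame_Basis[OF standard_basis])
  ultimately have fc: "framed_complex n \<Delta> e" by (simp add: framed_complex_def)
  show ?thesis
  proof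
    assume "represents_triangulation n e \<Delta>"
    then interpret triangulated_complex n \<Delta> e
      using fc by (simp add: triangulated_complex_def triangulated_complex_axioms_def)
    show "SA n (matching_faces \<Delta>) \<and> LA n (matching_faces \<Delta>)"
      using SA_holds LA_holds by blast
  next
    assume "SA n (matching_faces \<Delta>) \<and> LA n (matching_faces \<Delta>)"
    then interpret framed_matching_complex n \<Delta> e
      using fc by (simp add: framed_matching_complex_def framed_complex_def matching_complex_def
          matching_complex_axioms_def)
    show "represents_triangulation n e \<Delta>" by (rule represents)
  qed
qed

end
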